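(* Let $N\in\mathbb{N}$, $\alpha,\beta\in(-1,+\infty)$ and $1\le n\le N$. The roots $x_{1,n}^Q<\dots<x_{n,n}^Q$ of the Hahn polynomial $Q_n(x;\alpha,\beta,N)$ are real, simple, located in $(0,N)$, have mutual distances greater than $1$, and form the equilibrium distribution of $n$ charges in $(0,N)$, with exclusion radius $h=1$, under the external field $\phi^Q$ with force $$F_{\phi^Q}(x)=-(\phi^Q)'(x)=\frac12\log\left(\frac{(x+\alpha+1)(N-x)}{x(N+\beta+1-x)}\right),\qquad x\in(0,N).$$ Moreover, each root $x_{j,n}^Q$ increases with $\alpha$ and with $N$, and decreases with $\beta$.
   Context: Hahn polynomials: $Q_n(x;\alpha,\beta,N)=\sum_{k=0}^n\frac{(-n)_k(n+\alpha+\beta+1)_k(-x)_k}{k!\,(\alpha+1)_k(-N)_k}$, where $(u)_k=u(u+1)\cdots(u+k-1)$ is the Pochhammer symbol. They are orthogonal with respect to the discrete measure $\sum_{j=0}^N\binom{\alpha+j}{j}\binom{\beta+N-j}{N-j}\delta_j$, where $\delta_j$ is the Dirac delta at $j$; this measure is positive for $\alpha,\beta>-1$. Equilibrium distribution with $h=1$: the unit-charge potential is $V_x(y)=\frac{x-y}{2}\log\left(\frac{y-x+1}{y-x-1}\right)-\frac12\log\big((y-x+1)(y-x-1)\big)$ for $|y-x|>1$, the energy is $\mathcal{E}_\phi(x_1,\dots,x_n)=\sum_{j\neq k}V_{x_k}(x_j)+2\sum_{j=1}^n\phi(x_j)$, and an equilibrium distribution of $n$ charges in $(s,t)$ is a distribution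 $x_1<\dots<x_n$ with $x_{j+1}>x_j+1$ that minimizes $\mathcal{E}_\phi$ among all distributions of $n$ points in $(s,t)$ with mutual distances greater than $1$. *)

theory Defs
  imports Complex_Main "HOL-Computational_Algebra.Polynomial"
begin

definition hahn_poly :: "nat \<Rightarrow> real \<Rightarrow> real \<Rightarrow> nat \<Rightarrow> real poly" where
  "hahn_poly n \<alpha> \<beta> N =
     (\<Sum>k=0..n. smult
        (pochhammer (- real n) k * pochhammer (real n + \<alpha> + \<beta> + 1) k
          / (fact k * pochhammer (\<alpha> + 1) k * pochhammer (- real N) k))
        (pochhammer [:0, -1:] k))"

text \<open>The \<open>j\<close>-th smallest real root, counted from \<open>j = 1\<close>.\<close>

definition hahn_root :: "nat \<Rightarrow> real \<Rightarrow> real \<Rightarrow> nat \<Rightarrow> nat \<Rightarrow> real" where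
  "hahn_root n \<alpha> \<beta> N j = sorted_list_of_set {x. poly (hahn_poly n \<alpha> \<beta> N) x = 0} ! (j - 1)"

text \<open>The potential created at \<open>y\<close> by a unit charge at \<open>x\<close> (exclusion radius 1);
  it is meaningful only for \<open>\<bar>y - x\<bar> > 1\<close>.\<close>

definition potential :: "real \<Rightarrow> real \<Rightarrow> real" where
  "potential x y = (x - y) / 2 * ln ((y - x + 1) / (y - x - 1))
                   - 1 / 2 * ln ((y - x + 1) * (y - x - 1))"

text \<open>Here and below, a configuration of \<open>n\<close> points is a function on \<open>nat\<close> of which
  only the values on \<open>{1..n}\<close> matter.\<close>

definition energy :: "(real \<Rightarrow> real) \<Rightarrow> nat \<Rightarrow> (nat \<Rightarrow> real) \<Rightarrow> real" where
  "energy \<phi> n x = (\<Sum>j=1..n. \<Sum>k\<in>{1..n} - {j}. potential (x k) (x j)) + 2 * (\<Sum>j=1..n. \<phi> (x j))"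

definition admissible :: "real \<Rightarrow> real \<Rightarrow> nat \<Rightarrow> (nat \<Rightarrow> real) \<Rightarrow> bool" where
  "admissible s t n x \<longleftrightarrow>
     (\<forall>j\<in>{1..n}. x j \<in> {s<..<t}) \<and>
     (\<forall>j\<in>{1..n}. \<forall>k\<in>{1..n}. j \<noteq> k \<longrightarrow> \<bar>x j - x k\<bar> > 1)"

definition equilibrium :: "(real \<Rightarrow> real) \<Rightarrow> real \<Rightarrow> real \<Rightarrow> nat \<Rightarrow> (nat \<Rightarrow> real) \<Rightarrow> bool" where
  "equilibrium \<phi> s t n x \<longleftrightarrow>
     admissible s t n x \<and>
     (\<forall>j\<in>{1..<n}. x (j + 1) > x j + 1) \<and>
     (\<forall>y. admissible s t n y \<longrightarrow> energy \<phi> n x \<le> energy \<phi> n y)"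

text \<open>The external field is determined by its force only up to an additive constant.\<close>

definition has_force_on :: "(real \<Rightarrow> real) \<Rightarrow> (real \<Rightarrow> real) \<Rightarrow> real set \<Rightarrow> bool" where
  "has_force_on \<phi> F S \<longleftrightarrow> (\<forall>x\<in>S. (\<phi> has_real_derivative - F x) (at x))"

definition hahn_force :: "real \<Rightarrow> real \<Rightarrow> nat \<Rightarrow> real \<Rightarrow> real" where
  "hahn_force \<alpha> \<beta> N x =
     1 / 2 * ln ((x + \<alpha> + 1) * (real N - x) / (x * (real N + \<beta> + 1 - x)))"

end

theory Submission
  imports Defs "HOL-Analysis.Analysis"
begin

text \<open>The potential at distance \<open>d\<close> is \<open>(u (d - 1) - u (d + 1)) / 2\<close> with
  \<open>u t = t ln t\<close>, so the energy extends continuously to the compact set of configurations in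
  \<open>[0, N]\<close> with mutual distances at least \<open>1\<close>, and attains its minimum there. Since \<open>u\<close> has
  slope \<open>-\<infinity>\<close> at \<open>0\<close>, moving a boundary configuration towards the interior lowers the
  energy; hence every minimizer is an interior critical point. Exponentiating the force balance
  shows that \<open>p x = (\<Prod>j. x - x\<^sub>j)\<close> satisfies
  \<open>(x + \<alpha> + 1) (x - N) p (x + 1) + x (x - \<beta> - N - 1) p (x - 1) = 0\<close> at its own
  roots. Thus \<open>L p - \<lambda>\<^sub>n p\<close>, where \<open>L\<close> is the Hahn difference operator, has
  degree less than \<open>n\<close> and \<open>n\<close> roots, so it vanishes; in the basis \<open>(-x)\<^sub>k\<close>, where \<open>L\<close>
  is bidiagonal, this determines \<open>p\<close> up to a factor and identifies it with \<open>Q\<^sub>n\<close>. Monotonicity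
  in the parameters is a discrete maximum principle for the force balance.\<close>

section \<open>The difference equation\<close>

text \<open>For \<open>k > 0\<close> everything is a multiple of \<open>(-x)_(k-1)\<close>: the
  shift to \<open>x + 1\<close> puts the factor \<open>-(x + 1)\<close> in front of it, and the
  shift to \<open>x - 1\<close> needs the coefficient \<open>x\<close> to complete
  \<open>-(-x)_(k+1)\<close>. What remains is a polynomial identity. At \<open>k = 0\<close> the
  factor \<open>of_nat k\<close> makes the truncated \<open>k - 1\<close> harmless.\<close>

lemma hahn_operator_pochhammer:
  fixes x \<alpha> \<beta> M :: real
  shows "(x + \<alpha> + 1) * (x - M) * (pochhammer (- (x + 1)) k - pochhammer (- x) k)
      + x * (x - \<beta> - M - 1) * (pochhammer (- (x - 1)) k - pochhammer (- x) k)
    = of_nat k * (of_nat k + \<alpha> + \<beta> + 1) * pochhammer (- x) k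
      + of_nat k * (\<alpha> + of_nat k) * (M - of_nat k + 1) * pochhammer (- x) (k - 1)"
proof (cases k)
  case (Suc m)
  define P where "P = pochhammer (- x) m"
  have 1: "pochhammer (- x) k = P * (real m - x)"
    by (simp add: Suc P_def pochhammer_Suc algebra_simps)
  have 2: "pochhammer (- (x + 1)) k = - (x + 1) * P"
    by (simp add: Suc P_def pochhammer_rec)
  have "x * pochhammer (- (x - 1)) k = - pochhammer (- x) (Suc k)"
    by (subst pochhammer_rec) (simp add: algebra_simps)
  also have "\<dots> = - P * (real m - x) * (real m + 1 - x)"
    by (simp add: Suc P_def pochhammer_Suc algebra_simps)
  finally have 3: "x * pochhammer (- (x - 1)) k = - P * (real m - x) * (real m + 1 - x)" .
  have "x * (x - \<beta> - M - 1) * (pochhammer (- (x - 1)) k - pochhammer (- x) k)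
      = (x - \<beta> - M - 1) * (x * pochhammer (- (x - 1)) k - x * pochhammer (- x) k)"
    by (simp add: algebra_simps)
  then show ?thesis
    unfolding 3 unfolding 1 2 by (simp add: Suc P_def[symmetric] algebra_simps)
qed simp

text \<open>Multiplication by \<open>x - a\<close> sends \<open>(-x)_k\<close> to
  \<open>(k - a) (-x)_k - (-x)_(k+1)\<close>, which dictates the new coefficients
  \<open>d\<close>.\<close>

lemma prod_linear_eq_sum_pochhammer:
  fixes R :: "real set"
  assumes "finite R"
  shows "\<exists>c. \<forall>x. (\<Prod>b\<in>R. x - b) = (\<Sum>k\<le>card R. c k * pochhammer (- x) k)"
  using assms
proof (induction R)
  case empty
  show ?case by (intro exI[of _ "\<lambda>_. 1"]) simp
next
  case (insert a R)
  then obtain c where c: "\<And>x. (\<Prod>b\<in>R. x - b) = (\<Sum>k\<le>card R. c k * pochhammer (- x) k)"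
    by blast
  define n where "n = card R"
  define d where "d k = (if k \<le> n then (real k - a) * c k else 0) - (if k = 0 then 0 else c (k - 1))" for k
  have "(x - a) * (\<Sum>k\<le>n. c k * pochhammer (- x) k) = (\<Sum>k\<le>Suc n. d k * pochhammer (- x) k)" for x
  proof -
    have "(x - a) * (\<Sum>k\<le>n. c k * pochhammer (- x) k)
        = (\<Sum>k\<le>n. (real k - a) * c k * pochhammer (- x) k - c k * pochhammer (- x) (Suc k))"
      unfolding sum_distrib_left by (intro sum.cong refl) (simp add: pochhammer_Suc algebra_simps)
    also have "\<dots> = (\<Sum>k\<le>n. (real k - a) * c k * pochhammer (- x) k)
        - (\<Sum>k\<le>n. c k * pochhammer (- x) (Suc k))"
      by (rule sum_subtractf)
    also have "(\<Sum>k\<le>n. (real k - a) * c k * pochhammer (- x) k)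
        = (\<Sum>k\<le>Suc n. (if k \<le> n then (real k - a) * c k else 0) * pochhammer (- x) k)"
      by simp
    also have "(\<Sum>k\<le>n. c k * pochhammer (- x) (Suc k))
        = (\<Sum>k\<le>Suc n. (if k = 0 then 0 else c (k - 1)) * pochhammer (- x) k)"
      by (subst sum.atMost_Suc_shift) simp
    finally show ?thesis
      by (simp only: d_def left_diff_distrib sum_subtractf)
  qed
  with insert c show ?case
    by (intro exI[of _ d]) (simp add: n_def)
qed

text \<open>Evaluation at \<open>x = m\<close> is triangular: \<open>(-m)_k\<close> vanishes for
  \<open>k > m\<close> but not for \<open>k = m\<close>, and induction removes the lower
  terms.\<close>

lemma pochhammer_sum_eq_0_imp:
  fixes c :: "nat \<Rightarrow> real"
  assumes "\<And>x. (\<Sum>k<n. c k * pochhammer (- x) k) = 0" and "m < n"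
  shows "c m = 0"
  using assms(2)
proof (induction m rule: less_induct)
  case (less m)
  have "0 = (\<Sum>k<n. c k * pochhammer (- real m) k)"
    using assms(1) by simp
  also have "\<dots> = (\<Sum>k\<in>{m}. c k * pochhammer (- real m) k)"
  proof (rule sum.mono_neutral_right)
    show "\<forall>k\<in>{..<n} - {m}. c k * pochhammer (- real m) k = 0"
    proof
      fix k assume "k \<in> {..<n} - {m}"
      then consider "k < m" | "k > m" by fastforce
      then show "c k * pochhammer (- real m) k = 0"
        by cases (use less in \<open>auto simp: pochhammer_of_nat_eq_0_iff\<close>)
    qed
  qed (use less in auto)
  finally show ?case
    by (simp add: pochhammer_of_nat_eq_0_iff)
qed

lemma poly_pochhammer_linear:
  "poly (pochhammer [:0, -1::real:] k) x = pochhammer (- x) k"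
  by (simp add: pochhammer_prod poly_prod)

lemma degree_pochhammer_linear_le: "degree (pochhammer [:0, -1::real:] k) \<le> k"
proof -
  have "degree (pochhammer [:0, -1::real:] k) \<le> (\<Sum>i\<in>{0..<k}. degree ([:0, -1::real:] + of_nat i))"
    unfolding pochhammer_prod by (rule order.trans[OF degree_prod_sum_le]) (auto simp: o_def)
  also have "\<dots> \<le> (\<Sum>i\<in>{0..<k}. 1)"
    by (intro sum_mono degree_add_le) auto
  finally show ?thesis by simp
qed

text \<open>A polynomial of degree below \<open>n\<close> with \<open>n\<close> roots is zero;
  \<open>n = 0\<close> is split off because no degree lies below 0.\<close>

lemma pochhammer_sum_many_roots:
  fixes c :: "nat \<Rightarrow> real"
  assumes "finite R" "card R = n" "\<And>x. x \<in> R \<Longrightarrow> (\<Sum>k<n. c k * pochhammer (- x) k) = 0"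
  shows "(\<Sum>k<n. c k * pochhammer (- x) k) = 0"
proof (cases "n = 0")
  case False
  define r where "r = (\<Sum>k<n. smult (c k) (pochhammer [:0, -1:] k))"
  have r: "poly r x = (\<Sum>k<n. c k * pochhammer (- x) k)" for x
    by (simp add: r_def poly_sum poly_pochhammer_linear)
  have "degree r < n"
    unfolding r_def
  proof (rule degree_sum_less)
    show "degree (smult (c k) (pochhammer [:0, -1:] k)) < n" if "k \<in> {..<n}" for k
      using that le_less_trans[OF order.trans[OF degree_smult_le degree_pochhammer_linear_le]] by auto
  qed (use False in auto)
  have "r = 0"
  proof (rule ccontr)
    assume "r \<noteq> 0"
    have "n \<le> card {x. poly r x = 0}"
      using assms poly_roots_finite[OF \<open>r \<noteq> 0\<close>]
      by (auto simp: r simp flip: assms(2) intro!: card_mono)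
    also have "\<dots> \<le> degree r"
      by (rule card_poly_roots_bound) fact
    finally show False using \<open>degree r < n\<close> by simp
  qed
  then show ?thesis by (simp flip: r)
qed simp

text \<open>Subtracting the eigenvalue \<open>ev n\<close> cancels the term of index
  \<open>n\<close> in the image of the product under the operator. The hypothesis makes the
  remainder vanish on \<open>R\<close>, hence identically, and comparing coefficients gives a
  first-order recursion solved by the Hahn coefficients.\<close>

lemma hahn_poly_from_roots:
  fixes R :: "real set"
  assumes \<alpha>: "\<alpha> > -1" and \<beta>: "\<beta> > -1" and R: "finite R" "card R = n" and "n \<le> N"
    and eq: "\<And>a. a \<in> R \<Longrightarrow> (a + \<alpha> + 1) * (a - real N) * (\<Prod>b\<in>R. a + 1 - b)
                + a * (a - \<beta> - real N - 1) * (\<Prod>b\<in>R. a - 1 - b) = 0"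
  obtains c where "c \<noteq> 0" "(\<Prod>b\<in>R. [:- b, 1:]) = smult c (hahn_poly n \<alpha> \<beta> N)"
proof -
  obtain c where c: "\<And>x. (\<Prod>b\<in>R. x - b) = (\<Sum>k\<le>n. c k * pochhammer (- x) k)"
    using prod_linear_eq_sum_pochhammer[OF R(1)] R(2) by blast
  \<comment> \<open>\<open>ev\<close> is the diagonal and \<open>\<mu>\<close> the lowering
    coefficient of the operator in the basis \<open>(-x)_k\<close>.\<close>
  define ev where "ev k = real k * (real k + \<alpha> + \<beta> + 1)" for k
  define \<mu> where "\<mu> k = real k * (\<alpha> + real k) * (real N - real k + 1)" for k
  define d where "d k = c (Suc k) * \<mu> (Suc k) + (ev k - ev n) * c k" for k
  have L: "(x + \<alpha> + 1) * (x - real N) * ((\<Prod>b\<in>R. x + 1 - b) - (\<Prod>b\<in>R. x - b))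
       + x * (x - \<beta> - real N - 1) * ((\<Prod>b\<in>R. x - 1 - b) - (\<Prod>b\<in>R. x - b))
       - ev n * (\<Prod>b\<in>R. x - b) = (\<Sum>k<n. d k * pochhammer (- x) k)" for x
  proof -
    have "(x + \<alpha> + 1) * (x - real N) * ((\<Prod>b\<in>R. x + 1 - b) - (\<Prod>b\<in>R. x - b))
       + x * (x - \<beta> - real N - 1) * ((\<Prod>b\<in>R. x - 1 - b) - (\<Prod>b\<in>R. x - b))
       - ev n * (\<Prod>b\<in>R. x - b)
      = (\<Sum>k\<le>n. c k * ((x + \<alpha> + 1) * (x - real N) * (pochhammer (- (x + 1)) k - pochhammer (- x) k)
          + x * (x - \<beta> - real N - 1) * (pochhammer (- (x - 1)) k - pochhammer (- x) k))
          - ev n * (c k * pochhammer (- x) k))"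
      unfolding c by (simp add: sum_distrib_left sum_subtractf sum.distrib algebra_simps)
    also have "\<dots> = (\<Sum>k\<le>n. (ev k - ev n) * c k * pochhammer (- x) k + c k * \<mu> k * pochhammer (- x) (k - 1))"
      unfolding hahn_operator_pochhammer
      by (intro sum.cong refl) (simp add: ev_def \<mu>_def algebra_simps)
    also have "\<dots> = (\<Sum>k\<le>n. (ev k - ev n) * c k * pochhammer (- x) k)
        + (\<Sum>k\<le>n. c k * \<mu> k * pochhammer (- x) (k - 1))"
      by (rule sum.distrib)
    also have "(\<Sum>k\<le>n. (ev k - ev n) * c k * pochhammer (- x) k)
        = (\<Sum>k<n. (ev k - ev n) * c k * pochhammer (- x) k)"
      by (simp flip: lessThan_Suc_atMost)
    also have "(\<Sum>k\<le>n. c k * \<mu> k * pochhammer (- x) (k - 1))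
        = (\<Sum>k<n. c (Suc k) * \<mu> (Suc k) * pochhammer (- x) k)"
      by (subst sum.atMost_shift) (simp add: \<mu>_def)
    also have "(\<Sum>k<n. (ev k - ev n) * c k * pochhammer (- x) k) + \<dots>
        = (\<Sum>k<n. d k * pochhammer (- x) k)"
      unfolding sum.distrib[symmetric] by (intro sum.cong refl) (simp add: d_def algebra_simps)
    finally show ?thesis .
  qed
  have "(\<Sum>k<n. d k * pochhammer (- a) k) = 0" if "a \<in> R" for a
  proof -
    \<comment> \<open>At a root every term containing the product at \<open>a\<close> itself drops
      out, which leaves exactly the hypothesis \<open>eq\<close>.\<close>
    have "(\<Prod>b\<in>R. a - b) = 0"
      using that R by (auto intro: prod_zero)
    then show ?thesis
      using eq[OF that] by (simp flip: L)
  qed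
  then have "d k = 0" if "k < n" for k
    using pochhammer_sum_eq_0_imp[OF pochhammer_sum_many_roots[OF R]] that by blast
  then have rec: "c (Suc k) * \<mu> (Suc k) = (ev n - ev k) * c k" if "k < n" for k
    using that by (force simp: d_def algebra_simps)
  define a where "a k = pochhammer (- real n) k * pochhammer (real n + \<alpha> + \<beta> + 1) k
          / (fact k * pochhammer (\<alpha> + 1) k * pochhammer (- real N) k)" for k
  have ck: "c k = c 0 * a k" if "k \<le> n" for k
    using that
  proof (induction k)
    case (Suc k)
    have nz: "fact k \<noteq> (0::real)" "pochhammer (\<alpha> + 1) k \<noteq> 0" "pochhammer (- real N) k \<noteq> 0"
      using Suc.prems \<open>n \<le> N\<close> \<alpha>
      by (auto simp: pochhammer_of_nat_eq_0_iff pochhammer_eq_0_iff)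
    \<comment> \<open>\<open>n \<le> N\<close> and \<open>\<alpha> > -1\<close> keep the factors of
      \<open>\<mu> (Suc k)\<close> away from 0, so the recursion can be solved for
      \<open>c (Suc k)\<close>.\<close>
    have m: "real (Suc k) \<noteq> 0" "\<alpha> + 1 + real k \<noteq> 0" "real k - real N \<noteq> 0"
      using Suc.prems \<open>n \<le> N\<close> \<alpha> by auto
    have "c (Suc k) * \<mu> (Suc k) = (ev n - ev k) * (c 0 * a k)"
      using rec[of k] Suc by simp
    also have "(ev n - ev k) * a k = a (Suc k) * \<mu> (Suc k)"
    proof -
      have A: "a (Suc k) = a k * ((real k - real n) * (real n + \<alpha> + \<beta> + 1 + real k))
          / (real (Suc k) * (\<alpha> + 1 + real k) * (real k - real N))"
        by (simp add: a_def pochhammer_Suc mult_ac add_ac)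
      show ?thesis
        unfolding A using m by (simp add: \<mu>_def ev_def divide_simps) (simp add: algebra_simps)
    qed
    then have "(ev n - ev k) * (c 0 * a k) = c 0 * a (Suc k) * \<mu> (Suc k)"
      by (metis mult.assoc mult.left_commute)
    finally show ?case
      using m by (simp add: \<mu>_def)
  qed (simp add: a_def)
  have 1: "(\<Prod>b\<in>R. [:- b, 1:]) = smult (c 0) (hahn_poly n \<alpha> \<beta> N)"
  proof (rule poly_eq_poly_eq_iff[THEN iffD1], rule ext)
    fix x
    have "poly (\<Prod>b\<in>R. [:- b, 1:]) x = (\<Sum>k\<le>n. c k * pochhammer (- x) k)"
      using c[of x] by (simp add: poly_prod)
    also have "\<dots> = (\<Sum>k\<le>n. c 0 * a k * pochhammer (- x) k)"
      by (intro sum.cong refl arg_cong2[of _ _ _ _ "(*)"] ck) simp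
    also have "\<dots> = c 0 * (\<Sum>k=0..n. a k * pochhammer (- x) k)"
      by (simp only: sum_distrib_left atMost_atLeast0 mult.assoc)
    also have "\<dots> = poly (smult (c 0) (hahn_poly n \<alpha> \<beta> N)) x"
      by (simp add: hahn_poly_def poly_sum poly_pochhammer_linear a_def)
    finally show "poly (\<Prod>b\<in>R. [:- b, 1:]) x = poly (smult (c 0) (hahn_poly n \<alpha> \<beta> N)) x" .
  qed
  \<comment> \<open>A product of monic factors is nonzero, which rules out
    \<open>c 0 = 0\<close>.\<close>
  moreover have "(\<Prod>b\<in>R. [:- b, 1:]) \<noteq> 0"
    using R by auto
  ultimately show ?thesis
    using that by (metis smult_0_left)
qed

section \<open>The energy and its minimizers\<close>

text \<open>At \<open>d = 1\<close> the convention \<open>ln 0 = 0\<close> supplies the limit value,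
  so contact configurations have finite energy.\<close>

definition closed_potential :: "real \<Rightarrow> real" where
  "closed_potential d = ((d - 1) * ln (d - 1) - (d + 1) * ln (d + 1)) / 2"

text \<open>An explicit antiderivative of \<open>- hahn_force\<close>, built from
  \<open>t ln t\<close> terms so that it extends continuously to both endpoints.\<close>

definition hahn_field :: "real \<Rightarrow> real \<Rightarrow> nat \<Rightarrow> real \<Rightarrow> real" where
  "hahn_field \<alpha> \<beta> N x = (x * ln x + (real N - x) * ln (real N - x)
      - (x + \<alpha> + 1) * ln (x + \<alpha> + 1) - (real N + \<beta> + 1 - x) * ln (real N + \<beta> + 1 - x)) / 2"

definition hahn_energy :: "real \<Rightarrow> real \<Rightarrow> nat \<Rightarrow> nat \<Rightarrow> (nat \<Rightarrow> real) \<Rightarrow> real" where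
  "hahn_energy \<alpha> \<beta> N n x = (\<Sum>j=1..n. \<Sum>k\<in>{1..n} - {j}. closed_potential \<bar>x j - x k\<bar>)
      + 2 * (\<Sum>j=1..n. hahn_field \<alpha> \<beta> N (x j))"

definition closed_admissible :: "nat \<Rightarrow> nat \<Rightarrow> (nat \<Rightarrow> real) \<Rightarrow> bool" where
  "closed_admissible N n x \<longleftrightarrow> (\<forall>j\<in>{1..n}. x j \<in> {0..real N}) \<and>
     (\<forall>j\<in>{1..n}. \<forall>k\<in>{1..n}. j \<noteq> k \<longrightarrow> 1 \<le> \<bar>x j - x k\<bar>)"

definition hahn_minimizer :: "real \<Rightarrow> real \<Rightarrow> nat \<Rightarrow> nat \<Rightarrow> (nat \<Rightarrow> real) \<Rightarrow> bool" where
  "hahn_minimizer \<alpha> \<beta> N n x \<longleftrightarrow> closed_admissible N n x \<and>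
     (\<forall>y. closed_admissible N n y \<longrightarrow> hahn_energy \<alpha> \<beta> N n x \<le> hahn_energy \<alpha> \<beta> N n y)"

text \<open>Exchanging \<open>x\<close> and \<open>y\<close> inverts the quotient under the first
  logarithm and flips the sign in front of it, so only the distance matters.\<close>

lemma potential_eq_closed_potential:
  assumes "\<bar>y - x\<bar> > 1"
  shows "potential x y = closed_potential \<bar>y - x\<bar>"
proof -
  define d where "d = \<bar>y - x\<bar>"
  have d: "d > 1" using assms by (simp add: d_def)
  have 1: "ln ((d + 1) / (d - 1)) = ln (d + 1) - ln (d - 1)"
      "ln ((d - 1) / (d + 1)) = ln (d - 1) - ln (d + 1)"
      "ln ((d - 1) * (d + 1)) = ln (d - 1) + ln (d + 1)"
      "ln ((d + 1) * (d - 1)) = ln (d - 1) + ln (d + 1)"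
    using d by (auto simp: ln_div ln_mult)
  show ?thesis
  proof (cases "y > x")
    case True
    then have y: "y = x + d" by (simp add: d_def)
    have "y - x + 1 = d + 1" "y - x - 1 = d - 1"
      by (auto simp: y)
    then show ?thesis
      unfolding d_def[symmetric] potential_def closed_potential_def
      by (simp only: 1) (simp add: y algebra_simps diff_divide_distrib add_divide_distrib)
  next
    case False
    then have y: "y = x - d" by (simp add: d_def)
    have "(y - x + 1) / (y - x - 1) = (d - 1) / (d + 1)"
      "(y - x + 1) * (y - x - 1) = (d - 1) * (d + 1)"
      using d by (auto simp: y field_simps)
    then show ?thesis
      unfolding d_def[symmetric] potential_def closed_potential_def
      by (simp only: 1) (simp add: y algebra_simps diff_divide_distrib add_divide_distrib)
  qed
qed

lemma xlnx_has_derivative [derivative_intros]: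
  assumes "(f has_real_derivative D) (at x within S)" "f x > 0"
  shows "((\<lambda>t. f t * ln (f t)) has_real_derivative (ln (f x) + 1) * D) (at x within S)"
  using assms by (auto intro!: derivative_eq_intros simp: field_simps)

lemma hahn_field_has_force:
  assumes "\<alpha> > -1" "\<beta> > -1"
  shows "has_force_on (hahn_field \<alpha> \<beta> N) (hahn_force \<alpha> \<beta> N) {0<..<real N}"
  unfolding has_force_on_def
proof
  fix x assume "x \<in> {0<..<real N}"
  then have pos: "x > 0" "real N - x > 0" "x + \<alpha> + 1 > 0" "real N + \<beta> + 1 - x > 0"
    using assms by auto
  have "hahn_force \<alpha> \<beta> N x = (ln (x + \<alpha> + 1) + ln (real N - x)
      - (ln x + ln (real N + \<beta> + 1 - x))) / 2"
    unfolding hahn_force_def using pos by (simp add: ln_mult ln_div)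
  then have "- hahn_force \<alpha> \<beta> N x = ((ln x + 1) * 1 + (ln (real N - x) + 1) * - 1
      - (ln (x + \<alpha> + 1) + 1) * 1 - (ln (real N + \<beta> + 1 - x) + 1) * - 1) / 2"
    by simp
  moreover have "(hahn_field \<alpha> \<beta> N has_real_derivative ((ln x + 1) * 1 + (ln (real N - x) + 1) * - 1
      - (ln (x + \<alpha> + 1) + 1) * 1 - (ln (real N + \<beta> + 1 - x) + 1) * - 1) / 2) (at x)"
    unfolding hahn_field_def using pos
    by (intro DERIV_cdivide DERIV_diff DERIV_add xlnx_has_derivative)
      (auto intro!: derivative_eq_intros)
  ultimately show "(hahn_field \<alpha> \<beta> N has_real_derivative - hahn_force \<alpha> \<beta> N x) (at x)"
    by (simp only:)
qed

lemma closed_potential_has_derivative [derivative_intros]: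
  assumes "(f has_real_derivative D) (at x within S)" "f x > 1"
  shows "((\<lambda>t. closed_potential (f t)) has_real_derivative
           - (1 / 2 * ln ((f x + 1) / (f x - 1))) * D) (at x within S)"
proof -
  have "ln ((f x + 1) / (f x - 1)) = ln (f x + 1) - ln (f x - 1)"
    using assms by (simp add: ln_div)
  then have "- (1 / 2 * ln ((f x + 1) / (f x - 1))) * D
      = ((ln (f x - 1) + 1) * D - (ln (f x + 1) + 1) * D) / 2"
    by (simp only:) (simp add: algebra_simps diff_divide_distrib)
  moreover have "((\<lambda>t. closed_potential (f t)) has_real_derivative
      ((ln (f x - 1) + 1) * D - (ln (f x + 1) + 1) * D) / 2) (at x within S)"
    unfolding closed_potential_def using assms
    by (intro DERIV_cdivide DERIV_diff xlnx_has_derivative) (auto intro!: derivative_eq_intros)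
  ultimately show ?thesis by (simp only:)
qed

text \<open>One signed formula covers both sides: for \<open>a < b\<close> the quotient is the
  reciprocal of the one at distance \<open>b - a\<close>, so its logarithm changes sign together
  with the derivative of the absolute value.\<close>

lemma closed_potential_abs_has_derivative:
  assumes "\<bar>a - b\<bar> > 1"
  shows "((\<lambda>s. closed_potential \<bar>s - b\<bar>) has_real_derivative
           - (1 / 2 * ln ((a - b + 1) / (a - b - 1)))) (at a)"
proof (cases "a > b")
  case True
  then have "((\<lambda>s. closed_potential (s - b)) has_real_derivative
           - (1 / 2 * ln ((a - b + 1) / (a - b - 1)))) (at a)"
    using assms by (auto intro!: derivative_eq_intros)
  then show ?thesis
    by (rule has_field_derivative_transform_within_open[of _ _ _ "{b<..}"]) (use True in auto)
next
  case False
  then have *: "b - a > 1" using assms by simp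
  then have "(a - b + 1) / (a - b - 1) = inverse ((b - a + 1) / (b - a - 1))"
    by (simp add: field_simps)
  then have "ln ((a - b + 1) / (a - b - 1)) = - ln ((b - a + 1) / (b - a - 1))"
    using * by (simp only: ln_inverse)
  then have "((\<lambda>s. closed_potential (b - s)) has_real_derivative
           - (1 / 2 * ln ((a - b + 1) / (a - b - 1)))) (at a)"
    using * by (auto intro!: derivative_eq_intros)
  then show ?thesis
    by (rule has_field_derivative_transform_within_open[of _ _ _ "{..<b}"]) (use * in auto)
qed

section \<open>Continuity of the energy and existence of a minimizer\<close>

lemma abs_mult_ln_le: "\<bar>t * ln t\<bar> \<le> t\<^sup>2 + 2 * sqrt \<bar>t\<bar>" for t :: real
proof (cases "t = 0")
  case False
  define s where "s = \<bar>t\<bar>"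
  have s: "s > 0" using False by (simp add: s_def)
  have "ln s \<le> s" using ln_le_minus_one[OF s] by simp
  \<comment> \<open>Applying \<open>ln y \<le> y - 1\<close> at \<open>1 / sqrt s\<close> gives a
    bound that still tends to 0 after multiplication by \<open>s\<close>.\<close>
  moreover have "- ln s \<le> 2 * (1 / sqrt s)"
  proof -
    have "- ln s = 2 * ln (1 / sqrt s)"
      using s by (simp add: ln_div ln_sqrt)
    also have "\<dots> \<le> 2 * (1 / sqrt s)"
      using ln_le_minus_one[of "1 / sqrt s"] s by simp
    finally show ?thesis .
  qed
  ultimately have "\<bar>ln s\<bar> \<le> s + 2 * (1 / sqrt s)"
    using s by (simp add: abs_le_iff add_increasing2 add_increasing)
  then have "s * \<bar>ln s\<bar> \<le> s * (s + 2 * (1 / sqrt s))"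
    using s by (intro mult_left_mono) auto
  also have "\<dots> = s\<^sup>2 + 2 * (s / sqrt s)"
    by (simp add: power2_eq_square algebra_simps)
  also have "s / sqrt s = sqrt s"
    using s by (simp add: real_div_sqrt)
  also have "\<bar>ln s\<bar> = \<bar>ln t\<bar>"
    by (simp add: s_def abs_if ln_minus)
  finally show ?thesis
    by (simp add: s_def abs_mult)
qed simp

text \<open>The junk values \<open>ln 0 = 0\<close> and \<open>ln (- t) = ln t\<close> give continuity on the whole line.\<close>

lemma continuous_on_xlnx: "continuous_on UNIV (\<lambda>t::real. t * ln t)"
proof -
  have "isCont (\<lambda>t::real. t * ln t) a" for a
  proof (cases "a = 0")
    case True
    have "((\<lambda>t::real. t\<^sup>2 + 2 * sqrt \<bar>t\<bar>) \<longlongrightarrow> 0\<^sup>2 + 2 * sqrt \<bar>0\<bar>) (at 0)"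
      by (intro tendsto_intros)
    then have "((\<lambda>t::real. t\<^sup>2 + 2 * sqrt \<bar>t\<bar>) \<longlongrightarrow> 0) (at 0)"
      by simp
    then have "((\<lambda>t::real. t * ln t) \<longlongrightarrow> 0) (at 0)"
      by (rule Lim_null_comparison[rotated]) (use abs_mult_ln_le in auto)
    then show ?thesis
      by (simp add: isCont_def True)
  qed (auto intro!: continuous_intros)
  then show ?thesis
    by (simp add: continuous_on_eq_continuous_at)
qed

lemma hahn_minimizer_exists:
  assumes "n \<le> N"
  obtains x where "hahn_minimizer \<alpha> \<beta> N n x"
proof -
  \<comment> \<open>Coordinates outside \<open>{1..n}\<close> are frozen at 0, which makes the box
    compact in the product topology over all of \<open>nat\<close>; the separation conditions cut
    out a closed subset.\<close>
  define K where "K = (\<Pi>\<^sub>E i\<in>UNIV. if i \<in> {1..n} then {0..real N} else {0})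
      \<inter> (\<Inter>j\<in>{1..n}. \<Inter>k\<in>{1..n} - {j}. {x. 1 \<le> \<bar>x j - x k\<bar>})"
  have "compactin (product_topology (\<lambda>i. euclidean) UNIV)
      (\<Pi>\<^sub>E i\<in>UNIV. if i \<in> {1..n} then {0..real N} else {0})"
    by (subst compactin_PiE) auto
  then have cpt: "compact (\<Pi>\<^sub>E i\<in>UNIV. if i \<in> {1..n} then {0..real N} else {0})"
    by (simp add: euclidean_product_topology)
  have coord: "continuous_on A (\<lambda>x. x i)" for A and i :: nat
    by (rule continuous_on_subset[OF continuous_on_product_coordinates]) simp
  have "closed (\<Inter>j\<in>{1..n}. \<Inter>k\<in>{1..n} - {j}. {x. 1 \<le> \<bar>x j - x k :: real\<bar>})"
    by (intro closed_INT ballI closed_Collect_le continuous_intros coord)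
  with cpt have K: "compact K"
    unfolding K_def by (rule compact_Int_closed)
  have clamp: "(\<lambda>i. if i \<in> {1..n} then y i else 0) \<in> K" if "closed_admissible N n y" for y
    using that unfolding closed_admissible_def K_def by (auto simp: PiE_iff)
  have en: "hahn_energy \<alpha> \<beta> N n (\<lambda>i. if i \<in> {1..n} then y i else 0) = hahn_energy \<alpha> \<beta> N n y" for y
    unfolding hahn_energy_def by (intro arg_cong2[of _ _ _ _ "(+)"] arg_cong2[of _ _ _ _ "(*)"] sum.cong refl) auto
  \<comment> \<open>Unit spacing starting at \<open>1 / 2\<close> fits because
    \<open>n \<le> N\<close>; distances equal to 1 are allowed here, and the point only shows that
    \<open>K\<close> is nonempty.\<close>
  have "closed_admissible N n (\<lambda>i. real i - 1 / 2)"
    unfolding closed_admissible_def using assms by auto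
  then have "K \<noteq> {}" using clamp by blast
  have u: "continuous_on A (\<lambda>x. f x * ln (f x))" if "continuous_on A f"
    for A and f :: "(nat \<Rightarrow> real) \<Rightarrow> real"
    using continuous_on_compose2[OF continuous_on_xlnx that] by simp
  have "continuous_on K (hahn_energy \<alpha> \<beta> N n)"
    unfolding hahn_energy_def closed_potential_def hahn_field_def
    by (intro continuous_on_add continuous_on_sum continuous_on_mult continuous_on_const
        continuous_on_divide continuous_on_diff continuous_on_rabs u coord) auto
  from continuous_attains_inf[OF K \<open>K \<noteq> {}\<close> this] obtain x
    where x: "x \<in> K" "\<And>y. y \<in> K \<Longrightarrow> hahn_energy \<alpha> \<beta> N n x \<le> hahn_energy \<alpha> \<beta> N n y"
    by blast
  have "x j \<in> (if j \<in> {1..n} then {0..real N} else {0})" for j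
    using x(1) unfolding K_def PiE_iff by blast
  then have "x j \<in> {0..real N}" if "j \<in> {1..n}" for j
    using that by metis
  then have "closed_admissible N n x"
    using x(1) unfolding K_def closed_admissible_def by blast
  moreover have "hahn_energy \<alpha> \<beta> N n x \<le> hahn_energy \<alpha> \<beta> N n y" if "closed_admissible N n y" for y
    using x(2)[OF clamp[OF that]] en by simp
  ultimately show ?thesis
    using that unfolding hahn_minimizer_def by blast
qed

section \<open>One-sided slopes at 0\<close>

definition slope_bounded :: "(real \<Rightarrow> real) \<Rightarrow> bool" where
  "slope_bounded f \<longleftrightarrow> (\<exists>C. \<forall>\<^sub>F t in at_right 0. f t - f 0 \<le> C * t)"

text \<open>Linear upper bounds replace difference quotients: they add up termwise, also where a
  function has no finite derivative at 0.\<close>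

definition slope_minus_infinity :: "(real \<Rightarrow> real) \<Rightarrow> bool" where
  "slope_minus_infinity f \<longleftrightarrow> (\<forall>C. \<forall>\<^sub>F t in at_right 0. f t - f 0 \<le> C * t)"

lemma slope_minus_infinity_imp_bounded: "slope_minus_infinity f \<Longrightarrow> slope_bounded f"
  by (auto simp: slope_bounded_def slope_minus_infinity_def)

lemma slope_bounded_add:
  assumes "slope_bounded f" "slope_bounded g"
  shows "slope_bounded (\<lambda>t. f t + g t)"
proof -
  obtain C D where "\<forall>\<^sub>F t in at_right 0. f t - f 0 \<le> C * t" "\<forall>\<^sub>F t in at_right 0. g t - g 0 \<le> D * t"
    using assms unfolding slope_bounded_def by blast
  then have "\<forall>\<^sub>F t in at_right 0. f t + g t - (f 0 + g 0) \<le> (C + D) * t"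
    by eventually_elim (simp add: algebra_simps)
  then show ?thesis unfolding slope_bounded_def by blast
qed

lemma slope_minus_infinity_add:
  assumes "slope_minus_infinity f" "slope_bounded g"
  shows "slope_minus_infinity (\<lambda>t. f t + g t)"
  unfolding slope_minus_infinity_def
proof
  fix C
  obtain D where "\<forall>\<^sub>F t in at_right 0. g t - g 0 \<le> D * t"
    using assms unfolding slope_bounded_def by blast
  moreover have "\<forall>\<^sub>F t in at_right 0. f t - f 0 \<le> (C - D) * t"
    using assms unfolding slope_minus_infinity_def by blast
  ultimately show "\<forall>\<^sub>F t in at_right 0. f t + g t - (f 0 + g 0) \<le> C * t"
    by eventually_elim (simp add: algebra_simps)
qed

lemma slope_minus_infinity_add':
  assumes "slope_bounded f" "slope_minus_infinity g"
  shows "slope_minus_infinity (\<lambda>t. f t + g t)"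
  using slope_minus_infinity_add[OF assms(2,1)] by (simp add: add.commute)

lemma slope_bounded_cmult:
  assumes "slope_bounded f" "c > 0"
  shows "slope_bounded (\<lambda>t. c * f t)"
proof -
  obtain C where "\<forall>\<^sub>F t in at_right 0. f t - f 0 \<le> C * t"
    using assms unfolding slope_bounded_def by blast
  then have "\<forall>\<^sub>F t in at_right 0. c * f t - c * f 0 \<le> (c * C) * t"
  proof eventually_elim
    case (elim t)
    then have "c * (f t - f 0) \<le> c * (C * t)"
      using assms(2) by (intro mult_left_mono) auto
    then show ?case by (simp add: algebra_simps)
  qed
  then show ?thesis unfolding slope_bounded_def by blast
qed

lemma slope_minus_infinity_cmult:
  assumes "slope_minus_infinity f" "c > 0"
  shows "slope_minus_infinity (\<lambda>t. c * f t)"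
  unfolding slope_minus_infinity_def
proof
  fix C
  have "\<forall>\<^sub>F t in at_right 0. f t - f 0 \<le> (C / c) * t"
    using assms unfolding slope_minus_infinity_def by blast
  then show "\<forall>\<^sub>F t in at_right 0. c * f t - c * f 0 \<le> C * t"
    by eventually_elim (use assms(2) in \<open>simp add: field_simps\<close>)
qed

lemma slope_bounded_sum:
  assumes "\<And>i. i \<in> I \<Longrightarrow> slope_bounded (f i)"
  shows "slope_bounded (\<lambda>t. \<Sum>i\<in>I. f i t)"
proof (cases "finite I")
  case True
  then show ?thesis using assms
  proof (induction I)
    case empty
    show ?case by (auto simp: slope_bounded_def intro!: exI[of _ 0])
  qed (auto intro: slope_bounded_add)
qed (auto simp: slope_bounded_def intro!: exI[of _ 0])

text \<open>A single singular term decides, since terms with slope bounded above cannot compensate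
  it.\<close>

lemma slope_minus_infinity_sum:
  assumes "finite I" "j \<in> I" "slope_minus_infinity (f j)" "\<And>i. i \<in> I \<Longrightarrow> slope_bounded (f i)"
  shows "slope_minus_infinity (\<lambda>t. \<Sum>i\<in>I. f i t)"
proof -
  have "slope_minus_infinity (\<lambda>t. f j t + (\<Sum>i\<in>I - {j}. f i t))"
    using assms by (intro slope_minus_infinity_add slope_bounded_sum) auto
  then show ?thesis
    using assms by (simp add: sum.remove)
qed

lemma slope_bounded_derivative:
  assumes "(f has_real_derivative D) (at 0)"
  shows "slope_bounded f"
proof -
  have "((\<lambda>t. (f t - f 0) / t) \<longlongrightarrow> D) (at_right 0)"
    using assms by (auto simp: has_field_derivative_iff intro: filterlim_mono[OF _ order_refl at_le])
  then have "\<forall>\<^sub>F t in at_right 0. (f t - f 0) / t < D + 1"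
    by (rule order_tendstoD) simp
  then have "\<forall>\<^sub>F t in at_right 0. f t - f 0 \<le> (D + 1) * t"
    using eventually_at_right_less[of 0]
    by eventually_elim (simp add: pos_divide_less_eq)
  then show ?thesis unfolding slope_bounded_def by blast
qed

section \<open>Slopes of the terms of the energy along a segment\<close>

lemma slope_minus_infinity_xlnx:
  assumes "m > 0"
  shows "slope_minus_infinity (\<lambda>t. (t * m) * ln (t * m))"
  unfolding slope_minus_infinity_def
proof
  fix C
  \<comment> \<open>The threshold is the value of \<open>t\<close> at which
    \<open>m * ln (t * m)\<close> equals \<open>C\<close>.\<close>
  have "\<forall>\<^sub>F t in at_right 0. t < exp (C / m) / m"
    using assms by (intro order_tendstoD(2)[OF tendsto_ident_at]) auto
  then show "\<forall>\<^sub>F t in at_right 0. (t * m) * ln (t * m) - (0 * m) * ln (0 * m) \<le> C * t"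
    using eventually_at_right_less[of 0]
  proof eventually_elim
    case (elim t)
    then have "t * m < exp (C / m)" using assms by (simp add: field_simps)
    then have "ln (t * m) < C / m"
      using elim assms by (metis exp_less_cancel_iff exp_ln mult_pos_pos)
    then have "(t * m) * ln (t * m) \<le> (t * m) * (C / m)"
      using elim assms by (intro mult_left_mono) auto
    then show ?case using assms by (simp add: mult.commute[of C])
  qed
qed

text \<open>For \<open>a > 0\<close> the function is differentiable at 0. For \<open>a = 0\<close>
  the condition \<open>m > 0\<close> moves the argument to the right, where the slope is minus
  infinity and so bounded above.\<close>

lemma slope_bounded_xlnx:
  assumes "a \<ge> 0" "a = 0 \<Longrightarrow> m > 0"
  shows "slope_bounded (\<lambda>t. (a + t * m) * ln (a + t * m))"
proof (cases "a = 0")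
  case False
  then have "((\<lambda>t. (a + t * m) * ln (a + t * m)) has_real_derivative (ln (a + 0 * m) + 1) * m) (at 0)"
    using assms by (intro xlnx_has_derivative) (auto intro!: derivative_eq_intros)
  then show ?thesis by (rule slope_bounded_derivative)
qed (use assms in \<open>simp add: slope_minus_infinity_imp_bounded slope_minus_infinity_xlnx\<close>)

text \<open>Strict positivity of \<open>a\<close> avoids the singular slope at 0, which the minus
  sign could turn into plus infinity. For the external field it is met because
  \<open>\<alpha>\<close> and \<open>\<beta>\<close> exceed -1.\<close>

lemma slope_bounded_minus_xlnx:
  assumes "a > 0"
  shows "slope_bounded (\<lambda>t. - ((a + t * m) * ln (a + t * m)))"
proof -
  have "((\<lambda>t. - ((a + t * m) * ln (a + t * m))) has_real_derivative - ((ln (a + 0 * m) + 1) * m)) (at 0)"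
    using assms by (intro DERIV_minus xlnx_has_derivative) (auto intro!: derivative_eq_intros)
  then show ?thesis by (rule slope_bounded_derivative)
qed

lemma closed_potential_affine:
  "closed_potential (d + t * m) = (1 / 2) * (((d - 1) + t * m) * ln ((d - 1) + t * m)
     + - (((d + 1) + t * m) * ln ((d + 1) + t * m)))"
  by (simp add: closed_potential_def algebra_simps diff_divide_distrib add_divide_distrib)

lemma slope_bounded_closed_potential:
  assumes "d \<ge> 1" "d = 1 \<Longrightarrow> m > 0"
  shows "slope_bounded (\<lambda>t. closed_potential (d + t * m))"
  unfolding closed_potential_affine using assms
  by (intro slope_bounded_cmult slope_bounded_add slope_bounded_xlnx slope_bounded_minus_xlnx) auto

text \<open>At contact only \<open>(d - 1) ln (d - 1)\<close> is singular; the term with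
  \<open>d + 1\<close> stays differentiable.\<close>

lemma slope_minus_infinity_closed_potential:
  assumes "m > 0"
  shows "slope_minus_infinity (\<lambda>t. closed_potential (1 + t * m))"
  unfolding closed_potential_affine
  by (intro slope_minus_infinity_cmult slope_minus_infinity_add slope_bounded_minus_xlnx)
    (use slope_minus_infinity_xlnx[OF assms] in auto)

lemma hahn_field_affine:
  "hahn_field \<alpha> \<beta> N (x + t * m) = (1 / 2) * (
     ((x + t * m) * ln (x + t * m) + ((real N - x) + t * - m) * ln ((real N - x) + t * - m))
     + (- (((x + \<alpha> + 1) + t * m) * ln ((x + \<alpha> + 1) + t * m))
        + - (((real N + \<beta> + 1 - x) + t * - m) * ln ((real N + \<beta> + 1 - x) + t * - m))))"
proof -
  have "(real N - x) + t * - m = real N - (x + t * m)" "(x + \<alpha> + 1) + t * m = (x + t * m) + \<alpha> + 1"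
    "(real N + \<beta> + 1 - x) + t * - m = real N + \<beta> + 1 - (x + t * m)"
    by auto
  then show ?thesis
    unfolding hahn_field_def by (simp only:) simp
qed

text \<open>\<open>x + m\<close> plays the role of an interior target: it forces
  \<open>m > 0\<close> at \<open>x = 0\<close> and \<open>m < 0\<close> at
  \<open>x = real N\<close>, as the singular terms require.\<close>

lemma slope_bounded_hahn_field:
  assumes "\<alpha> > -1" "\<beta> > -1" "x \<in> {0..real N}" "x + m \<in> {0<..<real N}"
  shows "slope_bounded (\<lambda>t. hahn_field \<alpha> \<beta> N (x + t * m))"
  unfolding hahn_field_affine using assms
  by (intro slope_bounded_cmult slope_bounded_add slope_bounded_xlnx slope_bounded_minus_xlnx) auto

text \<open>At an endpoint exactly one of the two positive \<open>t ln t\<close> terms is singular,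
  and its argument grows from 0 because the motion is inward.\<close>

lemma slope_minus_infinity_hahn_field:
  assumes "\<alpha> > -1" "\<beta> > -1" "x = 0 \<or> x = real N" "x + m \<in> {0<..<real N}"
  shows "slope_minus_infinity (\<lambda>t. hahn_field \<alpha> \<beta> N (x + t * m))"
  using assms(3)
proof
  assume x: "x = 0"
  have "slope_minus_infinity (\<lambda>t. (x + t * m) * ln (x + t * m))"
    using slope_minus_infinity_xlnx[of m] assms x by simp
  then show ?thesis
    unfolding hahn_field_affine using assms x
    by (intro slope_minus_infinity_cmult slope_minus_infinity_add slope_bounded_add
        slope_bounded_xlnx slope_bounded_minus_xlnx) auto
next
  assume x: "x = real N"
  have "slope_minus_infinity (\<lambda>t. ((real N - x) + t * - m) * ln ((real N - x) + t * - m))"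
    using slope_minus_infinity_xlnx[of "- m"] assms x by simp
  then show ?thesis
    unfolding hahn_field_affine using assms x
    by (intro slope_minus_infinity_cmult slope_minus_infinity_add slope_minus_infinity_add'
        slope_bounded_add slope_bounded_xlnx slope_bounded_minus_xlnx) auto
qed

text \<open>The witness spreads the points out by \<open>1 + 1 / (n + 1)\<close> while keeping their order.\<close>

lemma spread_same_order:
  fixes x :: "nat \<Rightarrow> real"
  assumes "1 \<le> n" "n \<le> N" "inj_on x {1..n}"
  obtains z where "\<And>j. j \<in> {1..n} \<Longrightarrow> z j \<in> {0<..<real N}"
    "\<And>j k. j \<in> {1..n} \<Longrightarrow> k \<in> {1..n} \<Longrightarrow> x j < x k \<Longrightarrow> z k - z j > 1"
proof
  define r where "r j = card {k\<in>{1..n}. x k \<le> x j}" for j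
  \<comment> \<open>The point of rank \<open>r\<close> lands strictly between \<open>r - 1\<close>
    and \<open>r\<close>, so all of them lie in \<open>(0, n)\<close> and hence in
    \<open>(0, N)\<close>.\<close>
  define z where "z j = real (r j) - 1 + real (r j) / (real n + 1)" for j
  show "z j \<in> {0<..<real N}" if "j \<in> {1..n}" for j
  proof -
    have "r j \<noteq> 0" using that by (auto simp: r_def)
    then have r1: "real (r j) \<ge> 1" by simp
    have "r j \<le> n"
      unfolding r_def by (rule order.trans[OF card_mono[of "{1..n}"]]) auto
    then have rn: "real (r j) \<le> real n" by simp
    have "real (r j) / (real n + 1) < 1" "real (r j) / (real n + 1) > 0"
      using r1 rn by auto
    moreover have "real n \<le> real N" using assms(2) by simp
    ultimately have "z j > 0 \<and> z j < real N"
      unfolding z_def using r1 rn by linarith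
    then show ?thesis by simp
  qed
  show "z k - z j > 1" if "j \<in> {1..n}" "k \<in> {1..n}" "x j < x k" for j k
  proof -
    have "{i\<in>{1..n}. x i \<le> x j} \<subseteq> {i\<in>{1..n}. x i \<le> x k}"
      "k \<in> {i\<in>{1..n}. x i \<le> x k}" "k \<notin> {i\<in>{1..n}. x i \<le> x j}"
      using that by auto
    then have "r j < r k"
      unfolding r_def by (intro psubset_card_mono psubsetI) (simp, blast+)
    then have r: "real (r k) - real (r j) \<ge> 1" by simp
    then have "(real (r k) - real (r j)) / (real n + 1) > 0" by simp
    with r show ?thesis by (simp add: z_def diff_divide_distrib)
  qed
qed

text \<open>Along the segment from \<open>x\<close> to the spread-out \<open>z\<close> every energy
  term has slope bounded above, and a charge at an endpoint or a pair in contact contributes slope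
  minus infinity. The energy would then drop below its minimum.\<close>

lemma hahn_minimizer_interior:
  assumes \<alpha>\<beta>: "\<alpha> > -1" "\<beta> > -1" and n: "1 \<le> n" "n \<le> N" and min: "hahn_minimizer \<alpha> \<beta> N n x"
  shows "admissible 0 (real N) n x"
proof (rule ccontr)
  assume not_adm: "\<not> admissible 0 (real N) n x"
  have x: "\<And>j. j \<in> {1..n} \<Longrightarrow> x j \<in> {0..real N}"
      "\<And>j k. j \<in> {1..n} \<Longrightarrow> k \<in> {1..n} \<Longrightarrow> j \<noteq> k \<Longrightarrow> 1 \<le> \<bar>x j - x k\<bar>"
    and min': "\<And>y. closed_admissible N n y \<Longrightarrow> hahn_energy \<alpha> \<beta> N n x \<le> hahn_energy \<alpha> \<beta> N n y"
    using min unfolding hahn_minimizer_def closed_admissible_def by blast+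
  have "inj_on x {1..n}"
    using x(2) by (force simp: inj_on_def)
  then obtain z where z: "\<And>j. j \<in> {1..n} \<Longrightarrow> z j \<in> {0<..<real N}"
      "\<And>j k. j \<in> {1..n} \<Longrightarrow> k \<in> {1..n} \<Longrightarrow> x j < x k \<Longrightarrow> z k - z j > 1"
    using spread_same_order[OF n] by blast
  define m where "m j = z j - x j" for j
  define d where "d j k = \<bar>x j - x k\<bar>" for j k
  define e where "e j k = \<bar>z j - z k\<bar> - \<bar>x j - x k\<bar>" for j k
  \<comment> \<open>\<open>h\<close> is the energy along the segment, written with distances that
    are affine in \<open>t\<close>; it agrees with \<open>hahn_energy\<close> for \<open>t\<close>
    in \<open>{0..1}\<close>.\<close>
  define h where "h t = (\<Sum>j=1..n. \<Sum>k\<in>{1..n} - {j}. closed_potential (d j k + t * e j k))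
      + 2 * (\<Sum>j=1..n. hahn_field \<alpha> \<beta> N (x j + t * m j))" for t
  have d: "d j k \<ge> 1" "d j k = 1 \<Longrightarrow> e j k > 0" "\<bar>z j - z k\<bar> > 1"
    if "j \<in> {1..n}" "k \<in> {1..n} - {j}" for j k
  proof -
    show "d j k \<ge> 1" using x(2) that by (auto simp: d_def)
    then consider "x j < x k" | "x k < x j" by (force simp: d_def)
    then show *: "\<bar>z j - z k\<bar> > 1"
      using z(2)[of j k] z(2)[of k j] that by cases auto
    show "d j k = 1 \<Longrightarrow> e j k > 0"
      using * by (simp add: e_def d_def)
  qed
  have dist: "\<bar>(x j + t * m j) - (x k + t * m k)\<bar> = d j k + t * e j k" (is ?A)
      "1 \<le> \<bar>(x j + t * m j) - (x k + t * m k)\<bar>" (is ?B)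
    if jk: "j \<in> {1..n}" "k \<in> {1..n} - {j}" and t: "t \<in> {0..1}" for j k t
  proof -
    have D: "1 \<le> (1 - t) * d j k + t * \<bar>z j - z k\<bar>"
    proof -
      have "(1 - t) * 1 + t * 1 \<le> (1 - t) * d j k + t * \<bar>z j - z k\<bar>"
        using d(1,3)[OF jk] t by (intro add_mono mult_left_mono) auto
      then show ?thesis by simp
    qed
    have *: "(x j + t * m j) - (x k + t * m k) = (1 - t) * (x j - x k) + t * (z j - z k)"
      by (simp add: m_def algebra_simps)
    \<comment> \<open>Both ends of the segment order each pair alike, so the difference keeps its
      sign and the absolute value has no kink.\<close>
    consider "x j < x k" "z j < z k" | "x k < x j" "z k < z j"
      using d(1)[OF jk] z(2)[of j k] z(2)[of k j] jk by (force simp: d_def)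
    then have "\<bar>(x j + t * m j) - (x k + t * m k)\<bar> = (1 - t) * d j k + t * \<bar>z j - z k\<bar>"
    proof cases
      case 1
      then have "(x j + t * m j) - (x k + t * m k) = - ((1 - t) * d j k + t * \<bar>z j - z k\<bar>)"
        unfolding * by (simp add: d_def algebra_simps)
      then show ?thesis using D by simp
    next
      case 2
      then have "(x j + t * m j) - (x k + t * m k) = (1 - t) * d j k + t * \<bar>z j - z k\<bar>"
        unfolding * by (simp add: d_def algebra_simps)
      then show ?thesis using D by simp
    qed
    then show ?A ?B
      using D by (auto simp: e_def d_def algebra_simps)
  qed
  have h_ge: "h 0 \<le> h t" if "t \<in> {0..1}" for t
  proof -
    have en: "hahn_energy \<alpha> \<beta> N n (\<lambda>j. x j + t * m j) = h t" if "t \<in> {0..1}" for t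
      unfolding hahn_energy_def h_def using dist(1)[OF _ _ that]
      by (intro arg_cong2[of _ _ _ _ "(+)"] arg_cong2[of _ _ _ _ "(*)"] sum.cong refl) auto
    have "x j + t * m j \<in> {0..real N}" if "j \<in> {1..n}" for j
    proof -
      have "x j + t * m j = (1 - t) * x j + t * z j"
        by (simp add: m_def algebra_simps)
      moreover have "(1 - t) * x j + t * z j \<in> {0..real N}"
        using convexD_alt[OF convex_real_interval(5), of "x j" 0 "real N" "z j" t]
          x(1)[OF that] z(1)[OF that] \<open>t \<in> {0..1}\<close> by simp
      ultimately show ?thesis by simp
    qed
    then have "closed_admissible N n (\<lambda>j. x j + t * m j)"
      unfolding closed_admissible_def using dist(2)[OF _ _ that] by simp
    from min'[OF this] show ?thesis
      using en[of 0] en[OF that] by simp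
  qed
  have sb1: "slope_bounded (\<lambda>t. closed_potential (d j k + t * e j k))"
    if "j \<in> {1..n}" "k \<in> {1..n} - {j}" for j k
    using d[OF that] by (intro slope_bounded_closed_potential) auto
  have sb2: "slope_bounded (\<lambda>t. hahn_field \<alpha> \<beta> N (x j + t * m j))" if "j \<in> {1..n}" for j
    using x(1)[OF that] z(1)[OF that] \<alpha>\<beta> by (intro slope_bounded_hahn_field) (auto simp: m_def)
  consider j where "j \<in> {1..n}" "x j = 0 \<or> x j = real N"
    | j k where "j \<in> {1..n}" "k \<in> {1..n} - {j}" "d j k = 1"
    using not_adm x unfolding admissible_def d_def by force
  then have "slope_minus_infinity h"
  proof cases
    case (1 j)
    then have "slope_minus_infinity (\<lambda>t. hahn_field \<alpha> \<beta> N (x j + t * m j))"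
      using z(1)[OF 1(1)] \<alpha>\<beta> by (intro slope_minus_infinity_hahn_field) (auto simp: m_def)
    then show ?thesis
      unfolding h_def using sb1 sb2 1
      by (intro slope_minus_infinity_add' slope_minus_infinity_cmult slope_bounded_sum
          slope_minus_infinity_sum[of _ j]) auto
  next
    case (2 j k)
    then have "slope_minus_infinity (\<lambda>t. closed_potential (d j k + t * e j k))"
      using d(2) by (simp add: slope_minus_infinity_closed_potential)
    then have "slope_minus_infinity (\<lambda>t. \<Sum>k\<in>{1..n} - {j}. closed_potential (d j k + t * e j k))"
      using sb1 2 by (intro slope_minus_infinity_sum[of _ k]) auto
    then have "slope_minus_infinity (\<lambda>t. \<Sum>j=1..n. \<Sum>k\<in>{1..n} - {j}. closed_potential (d j k + t * e j k))"
      using 2(1) sb1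
      by (intro slope_minus_infinity_sum[where j = j and f = "\<lambda>j t. \<Sum>k\<in>{1..n} - {j}. closed_potential (d j k + t * e j k)"]
          slope_bounded_sum) auto
    then show ?thesis
      unfolding h_def
      by (rule slope_minus_infinity_add[OF _ slope_bounded_cmult[OF slope_bounded_sum[OF sb2]]]) auto
  qed
  \<comment> \<open>Any negative constant would do: it gives \<open>h t < h 0\<close> for small
    \<open>t > 0\<close>, against \<open>h_ge\<close>.\<close>
  then have "\<forall>\<^sub>F t in at_right 0. h t - h 0 \<le> -1 * t"
    unfolding slope_minus_infinity_def by (rule spec)
  moreover have "\<forall>\<^sub>F t in at_right 0. t < (1 :: real)"
    by (intro order_tendstoD(2)[OF tendsto_ident_at]) auto
  ultimately have "\<forall>\<^sub>F t in at_right (0::real). False"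
    using eventually_at_right_less[of 0]
  proof eventually_elim
    case (elim t)
    then show ?case using h_ge[of t] by simp
  qed
  then show False by simp
qed

section \<open>Force balance at minimizers and its algebraic form\<close>

definition force_balanced :: "(real \<Rightarrow> real) \<Rightarrow> real set \<Rightarrow> bool" where
  "force_balanced F R \<longleftrightarrow>
     (\<forall>a\<in>R. (\<Sum>b\<in>R - {a}. 1 / 2 * ln ((a - b + 1) / (a - b - 1))) + F a = 0)"

lemma force_balanced_image_iff:
  assumes "inj_on x I"
  shows "force_balanced F (x ` I) \<longleftrightarrow>
    (\<forall>j\<in>I. (\<Sum>k\<in>I - {j}. 1 / 2 * ln ((x j - x k + 1) / (x j - x k - 1))) + F (x j) = 0)"
proof -
  have "(\<Sum>b\<in>x ` I - {x j}. 1 / 2 * ln ((x j - b + 1) / (x j - b - 1)))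
      = (\<Sum>k\<in>I - {j}. 1 / 2 * ln ((x j - x k + 1) / (x j - x k - 1)))" if "j \<in> I" for j
  proof -
    have "x ` I - {x j} = x ` (I - {j})"
      using assms that by (auto dest: inj_onD)
    then show ?thesis
      using assms by (simp add: sum.reindex inj_on_diff)
  qed
  then show ?thesis
    unfolding force_balanced_def by simp
qed

text \<open>By symmetry the interactions of \<open>j\<close> occur once in its own row and once
  across the other rows. This isolates the dependence of the energy on a single charge.\<close>

lemma sum_pairs_remove:
  fixes f :: "'i \<Rightarrow> 'i \<Rightarrow> 'a::comm_ring_1"
  assumes "finite I" "j \<in> I" and sym: "\<And>i k. f i k = f k i"
  shows "(\<Sum>i\<in>I. \<Sum>k\<in>I - {i}. f i k)
    = 2 * (\<Sum>k\<in>I - {j}. f j k) + (\<Sum>i\<in>I - {j}. \<Sum>k\<in>I - {j} - {i}. f i k)"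
proof -
  have "(\<Sum>k\<in>I - {i}. f i k) = f j i + (\<Sum>k\<in>I - {j} - {i}. f i k)" if "i \<in> I - {j}" for i
  proof -
    have "I - {i} - {j} = I - {j} - {i}" by auto
    then show ?thesis
      using that assms by (subst sum.remove[of _ j]) auto
  qed
  then have "(\<Sum>i\<in>I - {j}. \<Sum>k\<in>I - {i}. f i k)
      = (\<Sum>i\<in>I - {j}. f j i) + (\<Sum>i\<in>I - {j}. \<Sum>k\<in>I - {j} - {i}. f i k)"
    by (simp add: sum.distrib)
  then show ?thesis
    using assms by (subst sum.remove[of _ j]) auto
qed

text \<open>With the other charges fixed, the energy as a function of one charge has a local minimum
  at an interior point, where its derivative is -2 times the total force on that charge.\<close>

lemma hahn_minimizer_force_balanced:
  assumes \<alpha>\<beta>: "\<alpha> > -1" "\<beta> > -1" and n: "1 \<le> n" "n \<le> N" and min: "hahn_minimizer \<alpha> \<beta> N n x"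
  shows "force_balanced (hahn_force \<alpha> \<beta> N) (x ` {1..n})"
proof -
  have adm: "\<And>j. j \<in> {1..n} \<Longrightarrow> x j \<in> {0<..<real N}"
      "\<And>j k. j \<in> {1..n} \<Longrightarrow> k \<in> {1..n} \<Longrightarrow> j \<noteq> k \<Longrightarrow> 1 < \<bar>x j - x k\<bar>"
    using hahn_minimizer_interior[OF assms] unfolding admissible_def by blast+
  have inj: "inj_on x {1..n}"
    using adm(2) by (force simp: inj_on_def)
  have "(\<Sum>k\<in>{1..n} - {j}. 1 / 2 * ln ((x j - x k + 1) / (x j - x k - 1))) + hahn_force \<alpha> \<beta> N (x j) = 0"
    if j: "j \<in> {1..n}" for j
  proof -
    define I where "I = {1..n} - {j}"
    define g where "g s = 2 * (\<Sum>k\<in>I. closed_potential \<bar>s - x k\<bar>) + 2 * hahn_field \<alpha> \<beta> N s" for s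
    have en: "hahn_energy \<alpha> \<beta> N n (x(j := s)) = g s
       + ((\<Sum>i\<in>I. \<Sum>k\<in>I - {i}. closed_potential \<bar>x i - x k\<bar>) + 2 * (\<Sum>i\<in>I. hahn_field \<alpha> \<beta> N (x i)))" for s
    proof -
      have "(\<Sum>i=1..n. hahn_field \<alpha> \<beta> N ((x(j := s)) i)) = hahn_field \<alpha> \<beta> N s + (\<Sum>i\<in>I. hahn_field \<alpha> \<beta> N (x i))"
        using j by (subst sum.remove[of _ j]) (auto simp: I_def intro!: sum.cong)
      moreover have "(\<Sum>i=1..n. \<Sum>k\<in>{1..n} - {i}. closed_potential \<bar>(x(j := s)) i - (x(j := s)) k\<bar>)
          = 2 * (\<Sum>k\<in>I. closed_potential \<bar>s - x k\<bar>) + (\<Sum>i\<in>I. \<Sum>k\<in>I - {i}. closed_potential \<bar>x i - x k\<bar>)"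
        using j by (subst sum_pairs_remove[of _ j])
          (auto simp: I_def abs_minus_commute intro!: arg_cong2[of _ _ _ _ "(+)"] sum.cong)
      ultimately show ?thesis
        unfolding hahn_energy_def g_def by (simp add: algebra_simps)
    qed
    have "(g has_real_derivative 2 * (\<Sum>k\<in>I. - (1 / 2 * ln ((x j - x k + 1) / (x j - x k - 1))))
            + 2 * - hahn_force \<alpha> \<beta> N (x j)) (at (x j))"
      unfolding g_def
    proof (intro DERIV_add DERIV_cmult DERIV_sum)
      show "((\<lambda>s. closed_potential \<bar>s - x k\<bar>) has_real_derivative
              - (1 / 2 * ln ((x j - x k + 1) / (x j - x k - 1)))) (at (x j))" if "k \<in> I" for k
        using adm(2)[of j k] j that by (intro closed_potential_abs_has_derivative) (auto simp: I_def)
      show "(hahn_field \<alpha> \<beta> N has_real_derivative - hahn_force \<alpha> \<beta> N (x j)) (at (x j))"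
        using hahn_field_has_force[OF \<alpha>\<beta>] adm(1)[OF j] by (simp add: has_force_on_def)
    qed
    \<comment> \<open>The strict constraints satisfied by \<open>x\<close> survive small
      displacements of \<open>x j\<close>, so global minimality of \<open>x\<close> gives a
      two-sided local minimum of \<open>g\<close>.\<close>
    moreover have "\<forall>\<^sub>F s in nhds (x j). g (x j) \<le> g s"
    proof -
      have "\<forall>\<^sub>F s in nhds (x j). s \<in> {0<..<real N}"
        using adm(1)[OF j] by (intro eventually_nhds_in_open) auto
      moreover have "\<forall>\<^sub>F s in nhds (x j). \<forall>k\<in>I. \<bar>s - x k\<bar> > 1"
      proof (intro eventually_ball_finite ballI)
        fix k assume "k \<in> I"
        have "((\<lambda>s. \<bar>s - x k\<bar>) \<longlongrightarrow> \<bar>x j - x k\<bar>) (nhds (x j))"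
          by (intro tendsto_intros filterlim_ident)
        then show "\<forall>\<^sub>F s in nhds (x j). \<bar>s - x k\<bar> > 1"
          by (rule order_tendstoD(1)) (use adm(2)[of j k] j \<open>k \<in> I\<close> in \<open>auto simp: I_def\<close>)
      qed (simp add: I_def)
      ultimately show ?thesis
      proof eventually_elim
        case (elim s)
        have "closed_admissible N n (x(j := s))"
          unfolding closed_admissible_def
          using elim adm by (force simp: I_def abs_minus_commute intro: less_imp_le)
        then have "hahn_energy \<alpha> \<beta> N n (x(j := x j)) \<le> hahn_energy \<alpha> \<beta> N n (x(j := s))"
          using min unfolding hahn_minimizer_def by simp
        then show ?case unfolding en by simp
      qed
    qed
    then obtain \<delta> where "\<delta> > 0" "\<forall>s. \<bar>x j - s\<bar> < \<delta> \<longrightarrow> g (x j) \<le> g s"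
      unfolding eventually_nhds_metric dist_real_def by (metis abs_minus_commute)
    ultimately have "2 * (\<Sum>k\<in>I. - (1 / 2 * ln ((x j - x k + 1) / (x j - x k - 1))))
            + 2 * - hahn_force \<alpha> \<beta> N (x j) = 0"
      by (rule DERIV_local_min)
    then show ?thesis
      unfolding sum_negf I_def by simp
  qed
  then show ?thesis
    unfolding force_balanced_image_iff[OF inj] by blast
qed

lemma force_balanced_imp_difference_equation:
  fixes R :: "real set"
  assumes \<alpha>\<beta>: "\<alpha> > -1" "\<beta> > -1" and R: "finite R" "R \<subseteq> {0<..<real N}"
    and sep: "\<And>a b. a \<in> R \<Longrightarrow> b \<in> R \<Longrightarrow> a \<noteq> b \<Longrightarrow> \<bar>a - b\<bar> > 1"
    and bal: "force_balanced (hahn_force \<alpha> \<beta> N) R" and a: "a \<in> R"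
  shows "(a + \<alpha> + 1) * (a - real N) * (\<Prod>b\<in>R. a + 1 - b)
                + a * (a - \<beta> - real N - 1) * (\<Prod>b\<in>R. a - 1 - b) = 0"
proof -
  have pos: "a > 0" "real N - a > 0" "a + \<alpha> + 1 > 0" "real N + \<beta> + 1 - a > 0"
    using R(2) a \<alpha>\<beta> by auto
  have q: "(a - b + 1) / (a - b - 1) > 0" "a - b - 1 \<noteq> 0" "a - b + 1 \<noteq> 0" if "b \<in> R - {a}" for b
    using sep[OF a, of b] that by (auto simp: zero_less_divide_iff)
  \<comment> \<open>\<open>P\<close> and \<open>f\<close> are the exponentials of twice the
    interaction force and twice the external force. Each quotient in \<open>P\<close> is positive by
    the separation, although its numerator and denominator may both be negative.\<close>
  define P where "P = (\<Prod>b\<in>R - {a}. (a - b + 1) / (a - b - 1))"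
  define f where "f = (a + \<alpha> + 1) * (real N - a) / (a * (real N + \<beta> + 1 - a))"
  have "P > 0" unfolding P_def using q by (intro prod_pos) auto
  have "f > 0" unfolding f_def using pos by simp
  have "ln (P * f) = ln P + ln f"
    using \<open>P > 0\<close> \<open>f > 0\<close> by (simp add: ln_mult)
  also have "ln P = (\<Sum>b\<in>R - {a}. ln ((a - b + 1) / (a - b - 1)))"
    unfolding P_def using q R by (intro ln_prod) auto
  also have "\<dots> + ln f = 2 * ((\<Sum>b\<in>R - {a}. 1 / 2 * ln ((a - b + 1) / (a - b - 1))) + hahn_force \<alpha> \<beta> N a)"
    by (simp add: hahn_force_def f_def sum_divide_distrib[symmetric])
  also have "\<dots> = 0"
    using bal a unfolding force_balanced_def by simp
  finally have "P * f = 1"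
    using \<open>P > 0\<close> \<open>f > 0\<close> by simp
  define U where "U = (\<Prod>b\<in>R - {a}. a - b + 1)"
  define V where "V = (\<Prod>b\<in>R - {a}. a - b - 1)"
  have "V \<noteq> 0" unfolding V_def using q R by auto
  have "P = U / V" by (simp add: P_def U_def V_def prod_dividef)
  with \<open>P * f = 1\<close> \<open>V \<noteq> 0\<close> pos
  have *: "U * ((a + \<alpha> + 1) * (real N - a)) = V * (a * (real N + \<beta> + 1 - a))"
    by (simp add: f_def field_simps)
  \<comment> \<open>The factor with \<open>b = a\<close> is 1 in the first product and -1 in the
    second; this sign turns the balance of two products into a vanishing sum.\<close>
  have "(\<Prod>b\<in>R. a + 1 - b) = U"
    unfolding U_def using R a by (subst prod.remove[of _ a]) (auto intro!: prod.cong)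
  moreover have "(\<Prod>b\<in>R. a - 1 - b) = - V"
    unfolding V_def using R a by (subst prod.remove[of _ a]) (auto intro!: prod.cong)
  ultimately show ?thesis
    using * by (simp add: algebra_simps)
qed

section \<open>Roots of the Hahn polynomials\<close>

lemma force_law_antimono:
  fixes d e :: real
  assumes "d \<le> e" "\<bar>d\<bar> > 1" "\<bar>e\<bar> > 1" "d > 0 \<longleftrightarrow> e > 0"
  shows "ln ((e + 1) / (e - 1)) \<le> ln ((d + 1) / (d - 1))"
proof -
  have "0 < (d - 1) * (e - 1)"
    using assms by (auto simp: zero_less_mult_iff)
  \<comment> \<open>The quotient is \<open>1 + 2 / (d - 1)\<close>, which decreases on each side of
    the gap \<open>[-1, 1]\<close>; the sign hypothesis keeps \<open>d\<close> and \<open>e\<close>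
    on the same side.\<close>
  then have "2 / (e - 1) \<le> 2 / (d - 1)"
    using assms(1) by (intro divide_left_mono) (auto simp: mult.commute)
  moreover have "(e + 1) / (e - 1) = 1 + 2 / (e - 1)" "(d + 1) / (d - 1) = 1 + 2 / (d - 1)"
    using assms by (auto simp: field_simps)
  moreover have "(e + 1) / (e - 1) > 0"
    using assms by (auto simp: zero_less_divide_iff)
  ultimately show ?thesis
    by (intro ln_mono) auto
qed

text \<open>Twice the force is \<open>ln (1 + (\<alpha> + 1) / u) - ln (1 + (\<beta> + 1) / (N -
  u))\<close>: increasing in \<open>\<alpha>\<close> and \<open>N\<close>, decreasing in
  \<open>\<beta>\<close> and in the position \<open>u\<close>. A strict change of one parameter
  makes one of the two fractions change strictly.\<close>

lemma hahn_force_strict_mono: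
  assumes "\<alpha> > -1" "\<beta>' > -1" "s > 0" "s \<le> t" "t < real N"
    and le: "\<alpha> \<le> \<alpha>'" "\<beta>' \<le> \<beta>" "N \<le> N'" and less: "\<alpha> < \<alpha>' \<or> \<beta>' < \<beta> \<or> N < N'"
  shows "hahn_force \<alpha> \<beta> N t < hahn_force \<alpha>' \<beta>' N' s"
proof -
  have eq: "hahn_force a b M u = (ln (1 + (a + 1) / u) - ln (1 + (b + 1) / (real M - u))) / 2"
    if "a > -1" "b > -1" "u > 0" "u < real M" for a b u M
  proof -
    have "1 + (a + 1) / u = (u + a + 1) / u" "1 + (b + 1) / (real M - u) = (real M + b + 1 - u) / (real M - u)"
      using that by (auto simp: field_simps)
    then show ?thesis
      using that by (simp add: hahn_force_def ln_mult ln_div)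
  qed
  have N: "real N \<le> real N'" using le by simp
  have 1: "(\<alpha> + 1) / t \<le> (\<alpha>' + 1) / s"
    using assms by (intro frac_le) auto
  have 2: "(\<beta>' + 1) / (real N' - s) \<le> (\<beta> + 1) / (real N - t)"
    using assms N by (intro frac_le) auto
  have "(\<alpha> + 1) / t < (\<alpha>' + 1) / s \<or> (\<beta>' + 1) / (real N' - s) < (\<beta> + 1) / (real N - t)"
    using less
  proof (elim disjE)
    assume "\<alpha> < \<alpha>'"
    then show ?thesis using assms by (intro disjI1 frac_less) auto
  next
    assume "\<beta>' < \<beta>"
    then show ?thesis using assms N by (intro disjI2 frac_less) auto
  next
    assume "N < N'"
    then have "real N - t < real N' - s" using assms by simp
    then show ?thesis using assms by (intro disjI2 frac_less2) auto
  qed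
  then have "ln (1 + (\<alpha> + 1) / t) < ln (1 + (\<alpha>' + 1) / s)
      \<or> ln (1 + (\<beta>' + 1) / (real N' - s)) < ln (1 + (\<beta> + 1) / (real N - t))"
    using assms N by (auto simp: ln_less_cancel_iff add_pos_nonneg)
  moreover have "ln (1 + (\<alpha> + 1) / t) \<le> ln (1 + (\<alpha>' + 1) / s)"
    using 1 assms by (intro ln_mono) (auto simp: add_pos_nonneg)
  moreover have "ln (1 + (\<beta>' + 1) / (real N' - s)) \<le> ln (1 + (\<beta> + 1) / (real N - t))"
    using 2 assms N by (intro ln_mono) (auto simp: add_pos_nonneg)
  ultimately have "ln (1 + (\<alpha> + 1) / t) - ln (1 + (\<beta> + 1) / (real N - t))
      < ln (1 + (\<alpha>' + 1) / s) - ln (1 + (\<beta>' + 1) / (real N' - s))"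
    by linarith
  then show ?thesis
    using assms N by (simp add: eq)
qed

text \<open>Maximum principle: look at the charge that is displaced least to the right. All other
  charges push it further to the right than before, so its displacement cannot be \<open>\<le> 0\<close>.\<close>

lemma force_balanced_comparison:
  fixes x x' :: "nat \<Rightarrow> real"
  assumes x: "strict_mono_on {1..n} x" "force_balanced F (x ` {1..n})"
      "\<And>j k. j \<in> {1..n} \<Longrightarrow> k \<in> {1..n} \<Longrightarrow> j \<noteq> k \<Longrightarrow> \<bar>x j - x k\<bar> > 1"
    and x': "strict_mono_on {1..n} x'" "force_balanced F' (x' ` {1..n})"
      "\<And>j k. j \<in> {1..n} \<Longrightarrow> k \<in> {1..n} \<Longrightarrow> j \<noteq> k \<Longrightarrow> \<bar>x' j - x' k\<bar> > 1"
    and F: "\<And>j. j \<in> {1..n} \<Longrightarrow> x' j \<le> x j \<Longrightarrow> F (x j) < F' (x' j)"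
    and i: "i \<in> {1..n}"
  shows "x i < x' i"
proof -
  define D where "D = (\<lambda>k. x' k - x k) ` {1..n}"
  have "finite D" "D \<noteq> {}" using i by (auto simp: D_def)
  then obtain j where j: "j \<in> {1..n}" "Min D = x' j - x j"
    using Min_in[of D] unfolding D_def by blast
  have min: "x' j - x j \<le> x' k - x k" if "k \<in> {1..n}" for k
    unfolding j(2)[symmetric] using \<open>finite D\<close> that by (intro Min_le) (auto simp: D_def)
  have "x j < x' j"
  proof (rule ccontr)
    assume "\<not> x j < x' j"
    then have le: "x' j \<le> x j" by simp
    \<comment> \<open>Minimality of the displacement of \<open>j\<close> means
      \<open>x' j - x' k \<le> x j - x k\<close>, and both enumerations being increasing gives these
      differences the same sign.\<close>
    have "ln ((x j - x k + 1) / (x j - x k - 1)) \<le> ln ((x' j - x' k + 1) / (x' j - x' k - 1))"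
      if "k \<in> {1..n} - {j}" for k
    proof (rule force_law_antimono)
      show "x' j - x' k > 0 \<longleftrightarrow> x j - x k > 0"
        using that j strict_mono_on_less[OF x(1), of k j] strict_mono_on_less[OF x'(1), of k j] by simp
    qed (use that j min[of k] x(3)[of j k] x'(3)[of j k] in auto)
    then have "(\<Sum>k\<in>{1..n} - {j}. 1 / 2 * ln ((x j - x k + 1) / (x j - x k - 1)))
        \<le> (\<Sum>k\<in>{1..n} - {j}. 1 / 2 * ln ((x' j - x' k + 1) / (x' j - x' k - 1)))"
      by (intro sum_mono) simp
    moreover have "(\<Sum>k\<in>{1..n} - {j}. 1 / 2 * ln ((x j - x k + 1) / (x j - x k - 1))) + F (x j) = 0"
      using x(2) j unfolding force_balanced_image_iff[OF strict_mono_on_imp_inj_on[OF x(1)]] by blast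
    moreover have "(\<Sum>k\<in>{1..n} - {j}. 1 / 2 * ln ((x' j - x' k + 1) / (x' j - x' k - 1))) + F' (x' j) = 0"
      using x'(2) j unfolding force_balanced_image_iff[OF strict_mono_on_imp_inj_on[OF x'(1)]] by blast
    ultimately show False
      using F[OF j(1) le] by linarith
  qed
  then show ?thesis using min[OF i] by simp
qed

text \<open>This holds for an arbitrary minimizer, so it also yields uniqueness up to labelling,
  without any convexity of the energy.\<close>

lemma hahn_minimizer_roots:
  assumes "\<alpha> > -1" "\<beta> > -1" "1 \<le> n" "n \<le> N" "hahn_minimizer \<alpha> \<beta> N n x"
  shows "\<exists>c. c \<noteq> 0 \<and> (\<Prod>b\<in>x ` {1..n}. [:- b, 1:]) = smult c (hahn_poly n \<alpha> \<beta> N)"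
    and "{a. poly (hahn_poly n \<alpha> \<beta> N) a = 0} = x ` {1..n}"
    and "inj_on x {1..n}"
proof -
  have adm: "\<And>j. j \<in> {1..n} \<Longrightarrow> x j \<in> {0<..<real N}"
      "\<And>j k. j \<in> {1..n} \<Longrightarrow> k \<in> {1..n} \<Longrightarrow> j \<noteq> k \<Longrightarrow> 1 < \<bar>x j - x k\<bar>"
    using hahn_minimizer_interior[OF assms] unfolding admissible_def by blast+
  show inj: "inj_on x {1..n}"
    using adm(2) by (force simp: inj_on_def)
  have "card (x ` {1..n}) = n" using card_image[OF inj] by simp
  moreover have "(a + \<alpha> + 1) * (a - real N) * (\<Prod>b\<in>x ` {1..n}. a + 1 - b)
      + a * (a - \<beta> - real N - 1) * (\<Prod>b\<in>x ` {1..n}. a - 1 - b) = 0" if "a \<in> x ` {1..n}" for a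
    using force_balanced_imp_difference_equation[OF assms(1,2) _ _ _ hahn_minimizer_force_balanced[OF assms] that]
      adm by blast
  ultimately obtain c where c: "c \<noteq> 0" "(\<Prod>b\<in>x ` {1..n}. [:- b, 1:]) = smult c (hahn_poly n \<alpha> \<beta> N)"
    using hahn_poly_from_roots[OF assms(1,2) _ _ \<open>n \<le> N\<close>, of "x ` {1..n}"] by blast
  then show "\<exists>c. c \<noteq> 0 \<and> (\<Prod>b\<in>x ` {1..n}. [:- b, 1:]) = smult c (hahn_poly n \<alpha> \<beta> N)"
    by blast
  have "poly (hahn_poly n \<alpha> \<beta> N) a = 0 \<longleftrightarrow> a \<in> x ` {1..n}" for a
  proof -
    have "c * poly (hahn_poly n \<alpha> \<beta> N) a = (\<Prod>b\<in>x ` {1..n}. a - b)"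
      using arg_cong[OF c(2), of "\<lambda>p. poly p a"] by (simp add: poly_prod)
    moreover have "(\<Prod>b\<in>x ` {1..n}. a - b) = 0 \<longleftrightarrow> a \<in> x ` {1..n}"
      by (subst prod_zero_iff) auto
    ultimately show ?thesis using c(1) by (metis mult_eq_0_iff)
  qed
  then show "{a. poly (hahn_poly n \<alpha> \<beta> N) a = 0} = x ` {1..n}" by blast
qed

section \<open>The sorted roots as a minimizer, and their monotonicity\<close>

lemma hahn_root_eqI:
  assumes "strict_mono_on {1..n} y" "y ` {1..n} = {x. poly (hahn_poly n \<alpha> \<beta> N) x = 0}" "j \<in> {1..n}"
  shows "hahn_root n \<alpha> \<beta> N j = y j"
proof -
  have "sorted_wrt (<) (map y [1..<Suc n])"
    unfolding sorted_wrt_map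
    by (rule sorted_wrt_mono_rel[OF _ sorted_wrt_upt]) (use assms(1) in \<open>auto simp: strict_mono_on_def\<close>)
  then have "sorted_list_of_set (set (map y [1..<Suc n])) = map y [1..<Suc n]"
    by (intro sorted_list_of_set.idem_if_sorted_distinct) (auto simp: strict_sorted_iff)
  moreover have "set (map y [1..<Suc n]) = {x. poly (hahn_poly n \<alpha> \<beta> N) x = 0}"
    using assms(2) by (simp add: atLeastLessThanSuc_atLeastAtMost del: upt_Suc)
  moreover have "map y [1..<Suc n] ! (j - 1) = y (1 + (j - 1))"
    by (rule nth_map_upt) (use assms(3) in auto)
  ultimately show ?thesis
    using assms(3) by (simp add: hahn_root_def del: upt_Suc)
qed

text \<open>The energy depends only on the set of positions, so a minimizer may be relabelled in
  increasing order.\<close>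

lemma hahn_energy_image:
  assumes "inj_on x {1..n}"
  shows "hahn_energy \<alpha> \<beta> N n x = (\<Sum>a\<in>x ` {1..n}. \<Sum>b\<in>x ` {1..n} - {a}. closed_potential \<bar>a - b\<bar>)
      + 2 * (\<Sum>a\<in>x ` {1..n}. hahn_field \<alpha> \<beta> N a)"
proof -
  have "(\<Sum>b\<in>x ` {1..n} - {x j}. closed_potential \<bar>x j - b\<bar>)
      = (\<Sum>k\<in>{1..n} - {j}. closed_potential \<bar>x j - x k\<bar>)" if "j \<in> {1..n}" for j
  proof -
    have "x ` {1..n} - {x j} = x ` ({1..n} - {j})"
      using assms that by (auto dest: inj_onD)
    then show ?thesis
      using assms by (simp add: sum.reindex inj_on_diff)
  qed
  then show ?thesis
    unfolding hahn_energy_def using assms by (simp add: sum.reindex)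
qed

lemma admissible_imp_closed_admissible: "admissible 0 (real N) n x \<Longrightarrow> closed_admissible N n x"
  unfolding admissible_def closed_admissible_def by (auto intro: less_imp_le)

lemma strict_mono_enumeration_exists:
  fixes R :: "real set"
  assumes "finite R" "card R = n"
  obtains y where "strict_mono_on {1..n} y" "y ` {1..n} = R"
proof
  define xs where "xs = sorted_list_of_set R"
  define y where "y j = xs ! (j - 1)" for j
  have xs: "length xs = n" "set xs = R" "sorted_wrt (<) xs"
    using assms by (auto simp: xs_def)
  show "strict_mono_on {1..n} y"
    unfolding strict_mono_on_def y_def using xs(1) sorted_wrt_nth_less[OF xs(3)] by auto
  have "y ` {1..n} = (!) xs ` ((\<lambda>j. j - 1) ` {1..n})"
    by (simp add: image_image y_def)
  also have "(\<lambda>j. j - 1) ` {1..n} = {..<n}"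
    by (force simp: image_iff Bex_def intro: exI[of _ "Suc _"])
  also have "(!) xs ` {..<n} = R"
    using xs by (auto simp: set_conv_nth)
  finally show "y ` {1..n} = R" .
qed

text \<open>The minimizer found by compactness carries arbitrary labels. Its positions are the
  roots, and sorting them produces \<open>hahn_root\<close> with the same energy and the same
  constraints.\<close>

lemma hahn_root_minimizer:
  assumes "\<alpha> > -1" "\<beta> > -1" "1 \<le> n" "n \<le> N"
  shows "hahn_minimizer \<alpha> \<beta> N n (hahn_root n \<alpha> \<beta> N)"
    and "strict_mono_on {1..n} (hahn_root n \<alpha> \<beta> N)"
    and "hahn_root n \<alpha> \<beta> N ` {1..n} = {x. poly (hahn_poly n \<alpha> \<beta> N) x = 0}"
proof -
  define R where "R = {x. poly (hahn_poly n \<alpha> \<beta> N) x = 0}"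
  define r where "r = hahn_root n \<alpha> \<beta> N"
  obtain x where x: "hahn_minimizer \<alpha> \<beta> N n x"
    using hahn_minimizer_exists[OF \<open>n \<le> N\<close>] by blast
  note roots = hahn_minimizer_roots[OF assms x]
  have R: "finite R" "card R = n"
    using roots(2) card_image[OF roots(3)] by (auto simp: R_def)
  obtain y where y: "strict_mono_on {1..n} y" "y ` {1..n} = R"
    using strict_mono_enumeration_exists[OF R] by blast
  have ry: "r j = y j" if "j \<in> {1..n}" for j
    unfolding r_def using y that by (intro hahn_root_eqI) (auto simp: R_def)
  show mono: "strict_mono_on {1..n} (hahn_root n \<alpha> \<beta> N)"
    using y(1) ry unfolding r_def by (simp add: strict_mono_on_def)
  have rR: "r ` {1..n} = R"
    using y(2) ry by (metis (no_types, lifting) image_cong)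
  then show "hahn_root n \<alpha> \<beta> N ` {1..n} = {x. poly (hahn_poly n \<alpha> \<beta> N) x = 0}"
    by (simp add: r_def R_def)
  have inj: "inj_on r {1..n}"
    using mono unfolding r_def by (rule strict_mono_on_imp_inj_on)
  have xR: "x ` {1..n} = R" using roots(2) by (simp add: R_def)
  have "hahn_energy \<alpha> \<beta> N n r = hahn_energy \<alpha> \<beta> N n x"
    unfolding hahn_energy_image[OF inj] hahn_energy_image[OF roots(3)] rR xR ..
  moreover have "closed_admissible N n r"
  proof -
    have adm: "closed_admissible N n x" using x by (simp add: hahn_minimizer_def)
    have "a \<in> {0..real N}" if "a \<in> R" for a
      using that adm unfolding xR[symmetric] closed_admissible_def by blast
    moreover have "1 \<le> \<bar>a - b\<bar>" if ab: "a \<in> R" "b \<in> R" "a \<noteq> b" for a b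
    proof -
      obtain i k where "i \<in> {1..n}" "k \<in> {1..n}" "a = x i" "b = x k"
        using ab unfolding xR[symmetric] by blast
      then show ?thesis
        using adm \<open>a \<noteq> b\<close> unfolding closed_admissible_def by metis
    qed
    moreover have "r j \<in> R" if "j \<in> {1..n}" for j
      using rR that by blast
    ultimately show ?thesis
      unfolding closed_admissible_def using inj by (simp add: inj_on_eq_iff)
  qed
  ultimately show "hahn_minimizer \<alpha> \<beta> N n (hahn_root n \<alpha> \<beta> N)"
    using x unfolding hahn_minimizer_def r_def by simp
qed

lemma hahn_root_admissible:
  assumes "\<alpha> > -1" "\<beta> > -1" "1 \<le> n" "n \<le> N"
  shows "admissible 0 (real N) n (hahn_root n \<alpha> \<beta> N)"
  using hahn_minimizer_interior[OF assms hahn_root_minimizer(1)[OF assms]] .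

text \<open>One statement with three weak inequalities and at least one strict one serves all three
  parameters.\<close>

lemma hahn_root_less:
  assumes "\<alpha> > -1" "\<beta>' > -1" "1 \<le> n" "n \<le> N" "j \<in> {1..n}"
    and le: "\<alpha> \<le> \<alpha>'" "\<beta>' \<le> \<beta>" "N \<le> N'" and less: "\<alpha> < \<alpha>' \<or> \<beta>' < \<beta> \<or> N < N'"
  shows "hahn_root n \<alpha> \<beta> N j < hahn_root n \<alpha>' \<beta>' N' j"
proof -
  have p: "\<alpha> > -1" "\<beta> > -1" "1 \<le> n" "n \<le> N" and p': "\<alpha>' > -1" "\<beta>' > -1" "1 \<le> n" "n \<le> N'"
    using assms by auto
  note adm = hahn_root_admissible[OF p, unfolded admissible_def]
    and adm' = hahn_root_admissible[OF p', unfolded admissible_def]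
  show ?thesis
  proof (rule force_balanced_comparison)
    show "hahn_force \<alpha> \<beta> N (hahn_root n \<alpha> \<beta> N k) < hahn_force \<alpha>' \<beta>' N' (hahn_root n \<alpha>' \<beta>' N' k)"
      if "k \<in> {1..n}" "hahn_root n \<alpha>' \<beta>' N' k \<le> hahn_root n \<alpha> \<beta> N k" for k
      using adm adm' that by (intro hahn_force_strict_mono assms(1,2) le less) auto
  qed (use adm adm' hahn_root_minimizer(2)[OF p] hahn_root_minimizer(2)[OF p']
         hahn_minimizer_force_balanced[OF p hahn_root_minimizer(1)[OF p]]
         hahn_minimizer_force_balanced[OF p' hahn_root_minimizer(1)[OF p']] assms(5) in auto)
qed

text \<open>Two fields with the same force differ by a constant \<open>b\<close> on the interval,
  which changes every energy by \<open>2 n b\<close>.\<close>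

lemma energy_eq_hahn_energy:
  assumes "\<alpha> > -1" "\<beta> > -1" "has_force_on \<phi> (hahn_force \<alpha> \<beta> N) {0<..<real N}"
  obtains c where "\<And>y. admissible 0 (real N) n y \<Longrightarrow> energy \<phi> n y = hahn_energy \<alpha> \<beta> N n y + c"
proof -
  define m where "m = real N / 2"
  define b where "b = \<phi> m - hahn_field \<alpha> \<beta> N m"
  have \<phi>: "\<phi> x = hahn_field \<alpha> \<beta> N x + b" if "x \<in> {0<..<real N}" for x
  proof -
    have "\<phi> x - hahn_field \<alpha> \<beta> N x = \<phi> m - hahn_field \<alpha> \<beta> N m"
    proof (rule DERIV_isconst3[of 0 "real N" x m "\<lambda>x. \<phi> x - hahn_field \<alpha> \<beta> N x"])
      fix u assume u: "u \<in> {0<..<real N}"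
      have "((\<lambda>x. \<phi> x - hahn_field \<alpha> \<beta> N x) has_real_derivative
          - hahn_force \<alpha> \<beta> N u - - hahn_force \<alpha> \<beta> N u) (at u)"
        using assms(3) hahn_field_has_force[OF assms(1,2), of N] u unfolding has_force_on_def
        by (intro DERIV_diff) auto
      then show "((\<lambda>x. \<phi> x - hahn_field \<alpha> \<beta> N x) has_real_derivative 0) (at u)" by simp
    qed (use that in \<open>auto simp: m_def\<close>)
    then show ?thesis by (simp add: b_def)
  qed
  have "energy \<phi> n y = hahn_energy \<alpha> \<beta> N n y + 2 * real n * b" if y: "admissible 0 (real N) n y" for y
  proof -
    have "(\<Sum>j=1..n. \<Sum>k\<in>{1..n} - {j}. potential (y k) (y j))
        = (\<Sum>j=1..n. \<Sum>k\<in>{1..n} - {j}. closed_potential \<bar>y j - y k\<bar>)"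
      using y unfolding admissible_def by (intro sum.cong refl potential_eq_closed_potential) auto
    moreover have "(\<Sum>j=1..n. \<phi> (y j)) = (\<Sum>j=1..n. hahn_field \<alpha> \<beta> N (y j) + b)"
      using y unfolding admissible_def by (intro sum.cong refl \<phi>) auto
    ultimately show ?thesis
      unfolding energy_def hahn_energy_def by (simp add: sum.distrib algebra_simps)
  qed
  then show ?thesis using that by blast
qed

section \<open>Complex roots and their multiplicities\<close>

lemma map_poly_of_real_mult:
  "map_poly complex_of_real (p * q) = map_poly of_real p * map_poly of_real q"
  by (simp add: poly_eq_iff coeff_map_poly coeff_mult)

lemma map_poly_of_real_prod_linear:
  assumes "finite R"
  shows "map_poly complex_of_real (\<Prod>b\<in>R. [:- b, 1:]) = (\<Prod>b\<in>R. [:- complex_of_real b, 1:])"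
  using assms by (induction R) (simp_all add: map_poly_of_real_mult map_poly_pCons del: mult_pCons_left)

lemma order_prod_linear:
  fixes R :: "'a::idom set"
  assumes "finite R" "a \<in> R"
  shows "order a (\<Prod>b\<in>R. [:- b, 1:]) = 1"
proof -
  have "(\<Prod>b\<in>R. [:- b, 1:]) = [:- a, 1:] * (\<Prod>b\<in>R - {a}. [:- b, 1:])"
    using assms by (rule prod.remove)
  moreover have "order a (\<Prod>b\<in>R - {a}. [:- b, 1:]) = 0"
    using assms by (intro order_0I) (simp add: poly_prod)
  moreover have "order a [:- a, 1:] = 1"
    using order_power_n_n[of a 1] by simp
  moreover have "[:- a, 1:] * (\<Prod>b\<in>R - {a}. [:- b, 1:]) \<noteq> 0"
    using assms by (auto simp del: mult_pCons_left)
  ultimately show ?thesis by (simp add: order_mult del: mult_pCons_left)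
qed

theorem mainTheorem12:
  fixes \<alpha> \<beta> :: real and N n :: nat
  assumes "\<alpha> > -1" and "\<beta> > -1" and "1 \<le> n" and "n \<le> N"
  shows "(\<forall>z::complex. poly (map_poly complex_of_real (hahn_poly n \<alpha> \<beta> N)) z = 0 \<longrightarrow>
            z \<in> \<real> \<and> order z (map_poly complex_of_real (hahn_poly n \<alpha> \<beta> N)) = 1)
    \<and> {x. poly (hahn_poly n \<alpha> \<beta> N) x = 0} = hahn_root n \<alpha> \<beta> N ` {1..n}
    \<and> strict_mono_on {1..n} (hahn_root n \<alpha> \<beta> N)
    \<and> (\<forall>j\<in>{1..n}. hahn_root n \<alpha> \<beta> N j \<in> {0<..<real N})
    \<and> (\<forall>j\<in>{1..n}. \<forall>k\<in>{1..n}. j \<noteq> k \<longrightarrow>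
          \<bar>hahn_root n \<alpha> \<beta> N j - hahn_root n \<alpha> \<beta> N k\<bar> > 1)
    \<and> (\<exists>\<phi>. has_force_on \<phi> (hahn_force \<alpha> \<beta> N) {0<..<real N})
    \<and> (\<forall>\<phi>. has_force_on \<phi> (hahn_force \<alpha> \<beta> N) {0<..<real N} \<longrightarrow>
          equilibrium \<phi> 0 (real N) n (hahn_root n \<alpha> \<beta> N) \<and>
          (\<forall>y. equilibrium \<phi> 0 (real N) n y \<longrightarrow> (\<forall>j\<in>{1..n}. y j = hahn_root n \<alpha> \<beta> N j)))
    \<and> (\<forall>j\<in>{1..n}. strict_mono_on {-1<..} (\<lambda>a. hahn_root n a \<beta> N j))
    \<and> (\<forall>j\<in>{1..n}. strict_mono_on {n..} (\<lambda>M. hahn_root n \<alpha> \<beta> M j))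
    \<and> (\<forall>j\<in>{1..n}. strict_antimono_on {-1<..} (\<lambda>b. hahn_root n \<alpha> b N j))"
proof (intro conjI)
  define Q where "Q = map_poly complex_of_real (hahn_poly n \<alpha> \<beta> N)"
  define r where "r = hahn_root n \<alpha> \<beta> N"
  note min = hahn_root_minimizer[OF assms]
  have adm: "admissible 0 (real N) n r"
    unfolding r_def by (rule hahn_root_admissible[OF assms])
  have gap: "r (j + 1) > r j + 1" if "j \<in> {1..<n}" for j
  proof -
    have "r j < r (j + 1)"
      using strict_mono_onD[OF min(2), of j "j + 1"] that by (simp add: r_def)
    moreover have "1 < \<bar>r j - r (j + 1)\<bar>"
      using adm that unfolding admissible_def by simp
    ultimately show ?thesis by simp
  qed
  show "\<forall>z::complex. poly Q z = 0 \<longrightarrow> z \<in> \<real> \<and> order z Q = 1"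
  proof (intro allI impI)
    fix z assume z: "poly Q z = 0"
    define R where "R = hahn_root n \<alpha> \<beta> N ` {1..n}"
    have R: "finite R" by (simp add: R_def)
    \<comment> \<open>Over the complex numbers the factorization into distinct real linear factors
      persists, so no further roots appear and each one is simple.\<close>
    obtain c where c: "c \<noteq> 0" "(\<Prod>b\<in>R. [:- b, 1:]) = smult c (hahn_poly n \<alpha> \<beta> N)"
      using hahn_minimizer_roots(1)[OF assms min(1)] unfolding R_def by blast
    have "smult (of_real c) Q = map_poly complex_of_real (\<Prod>b\<in>R. [:- b, 1:])"
      unfolding c(2) Q_def by (simp add: poly_eq_iff coeff_map_poly)
    also have "\<dots> = (\<Prod>b\<in>R. [:- complex_of_real b, 1:])"
      by (rule map_poly_of_real_prod_linear[OF R])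
    also have "\<dots> = (\<Prod>b\<in>complex_of_real ` R. [:- b, 1:])"
      by (simp add: prod.reindex inj_on_def)
    finally have Q: "smult (of_real c) Q = (\<Prod>b\<in>complex_of_real ` R. [:- b, 1:])" .
    have "(\<Prod>b\<in>complex_of_real ` R. z - b) = poly (smult (of_real c) Q) z"
      unfolding Q by (simp add: poly_prod)
    also have "\<dots> = 0" using z by simp
    finally have zR: "z \<in> complex_of_real ` R"
      using R by (subst (asm) prod_zero_iff) auto
    then have "order z (smult (of_real c) Q) = 1"
      unfolding Q using R by (intro order_prod_linear) auto
    with zR c(1) show "z \<in> \<real> \<and> order z Q = 1"
      by (auto simp: order_smult)
  qed
  show "{x. poly (hahn_poly n \<alpha> \<beta> N) x = 0} = hahn_root n \<alpha> \<beta> N ` {1..n}"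
    using min(3) by simp
  show "strict_mono_on {1..n} (hahn_root n \<alpha> \<beta> N)"
    by (rule min(2))
  show "\<forall>j\<in>{1..n}. hahn_root n \<alpha> \<beta> N j \<in> {0<..<real N}"
    "\<forall>j\<in>{1..n}. \<forall>k\<in>{1..n}. j \<noteq> k \<longrightarrow> \<bar>hahn_root n \<alpha> \<beta> N j - hahn_root n \<alpha> \<beta> N k\<bar> > 1"
    using adm unfolding admissible_def r_def by blast+
  show "\<exists>\<phi>. has_force_on \<phi> (hahn_force \<alpha> \<beta> N) {0<..<real N}"
    using hahn_field_has_force[OF assms(1,2)] by blast
  show "\<forall>\<phi>. has_force_on \<phi> (hahn_force \<alpha> \<beta> N) {0<..<real N} \<longrightarrow>
          equilibrium \<phi> 0 (real N) n (hahn_root n \<alpha> \<beta> N) \<and>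
          (\<forall>y. equilibrium \<phi> 0 (real N) n y \<longrightarrow> (\<forall>j\<in>{1..n}. y j = hahn_root n \<alpha> \<beta> N j))"
  proof (intro allI impI conjI ballI)
    fix \<phi> assume "has_force_on \<phi> (hahn_force \<alpha> \<beta> N) {0<..<real N}"
    then obtain c where c: "\<And>y. admissible 0 (real N) n y \<Longrightarrow> energy \<phi> n y = hahn_energy \<alpha> \<beta> N n y + c"
      using energy_eq_hahn_energy[OF assms(1,2)] by blast
    show "equilibrium \<phi> 0 (real N) n (hahn_root n \<alpha> \<beta> N)"
      unfolding equilibrium_def r_def[symmetric]
      using adm gap min(1) c admissible_imp_closed_admissible
      by (auto simp: hahn_minimizer_def r_def)
    fix y j assume y: "equilibrium \<phi> 0 (real N) n y" and j: "j \<in> {1..n}"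
    have y_adm: "admissible 0 (real N) n y" using y by (simp add: equilibrium_def)
    have "energy \<phi> n y \<le> energy \<phi> n r"
      using y adm by (simp add: equilibrium_def)
    \<comment> \<open>The closed minimizer \<open>r\<close> is interior, so the open and closed
      problems share their minimum. An equilibrium \<open>y\<close> therefore minimizes the closed
      problem too, and its positions are the roots.\<close>
    then have "hahn_energy \<alpha> \<beta> N n y \<le> hahn_energy \<alpha> \<beta> N n r"
      using c[OF y_adm] c[OF adm] by simp
    then have "hahn_minimizer \<alpha> \<beta> N n y"
      using min(1) admissible_imp_closed_admissible[OF y_adm]
      unfolding hahn_minimizer_def r_def by (meson order.trans)
    then have "y ` {1..n} = {x. poly (hahn_poly n \<alpha> \<beta> N) x = 0}"
      using hahn_minimizer_roots(2)[OF assms] by simp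
    \<comment> \<open>The gap condition on consecutive charges fixes the labels, so equal sets of
      positions give equality index by index.\<close>
    moreover have "strict_mono_on {1..n} y"
    proof (rule strict_mono_onI)
      fix i k assume "i \<in> {1..n}" "k \<in> {1..n}" "i < k"
      then have "Suc i \<le> k" "1 \<le> i" "k \<le> n" by auto
      then show "y i < y k"
      proof (induction k rule: dec_induct)
        case base
        then show ?case using y by (force simp: equilibrium_def)
      next
        case (step k)
        then have "y k + 1 < y (k + 1)"
          using y unfolding equilibrium_def by auto
        then show ?case using step by simp
      qed
    qed
    ultimately show "y j = hahn_root n \<alpha> \<beta> N j"
      using hahn_root_eqI[of n y \<alpha> \<beta> N j] j by simp
  qed
  show "\<forall>j\<in>{1..n}. strict_mono_on {-1<..} (\<lambda>a. hahn_root n a \<beta> N j)"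
    "\<forall>j\<in>{1..n}. strict_mono_on {n..} (\<lambda>M. hahn_root n \<alpha> \<beta> M j)"
    "\<forall>j\<in>{1..n}. strict_antimono_on {-1<..} (\<lambda>b. hahn_root n \<alpha> b N j)"
    using assms by (auto intro!: strict_mono_onI monotone_onI hahn_root_less)
qed

end
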